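(* Let $U$ be the multi-mixed fractional Ornstein--Uhlenbeck process with parameters $\lambda>0$ and $\sigma_k,H_k$, $k\in\mathbb{N}$, let $\rho_\lambda(t)=\mathbb{E}[U_sU_{s+t}]$ be its autocovariance function, and let $H_{\sup}=\sup_kH_k$. Then for each $N=1,2,\ldots$, as $t\to\infty$, $$\rho_\lambda(t)=\frac12\sum_{k=1}^\infty\sum_{n=1}^N\sigma_k^2\lambda^{-2n}\left(\prod_{j=0}^{2n-1}(2H_k-j)\right)t^{2H_k-2n}+O\left(t^{2H_{\sup}-2N-2}\right).$$ Consequently, the process $U$ is long-range dependent if and only if $H_k>\frac12$ for some $k\ge1$.
   Context: A two-sided fractional Brownian motion (fBm) with Hurst index $H\in(0,1)$ is a centered Gaussian process $(B^H_t)_{t\in\mathbb{R}}$ with continuous paths and covariance $\mathbb{E}[B^H_tB^H_s]=\frac12\left(|t|^{2H}+|s|^{2H}-|t-s|^{2H}\right)$. Multi-mixed fractional Brownian motion (mmfBm): let $\sigma_k>0$, $k\in\mathbb{N}$, satisfy $\sum_{k=1}^\infty\sigma_k^2<\infty$, and let $H_k\in(0,1)$, $k\in\mathbb{N}$, be pairwise distinct with $\inf_kH_k>0$ and $\sup_kH_k<1$. With independent two-sided fBm's $B^{H_k}$, put $M_t=\sum_{k=1}^\infty\sigma_kB^{H_k}_t$, $t\in\mathbb{R}$, the series converging in $L^2(\Omega)$ for each $t$; $M$ is taken in its continuous version. Multi-mixed fractional Ornstein--Uhlenbeck process (mmfOU) with parameter $\lambda>0$: the stationary solution of $\mathrm{d}U_t=-\lambda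 U_t\,\mathrm{d}t+\mathrm{d}M_t$, that is, $U_t=\int_{-\infty}^t\mathrm{e}^{-\lambda(t-s)}\,\mathrm{d}M_s=M_t-\lambda\int_{-\infty}^t\mathrm{e}^{-\lambda(t-s)}M_s\,\mathrm{d}s$. A stationary process with autocovariance function $\rho(t)$ is long-range dependent if $\int_{t_0}^\infty|\rho(t)|\,\mathrm{d}t=\infty$ for some (equivalently all) $t_0>0$, and short-range dependent otherwise. *)

theory Defs
  imports "HOL-Probability.Probability"
begin

text \<open>A process on a probability space \<open>P\<close> is a function \<open>X :: real \<Rightarrow> 'a \<Rightarrow> real\<close>, written \<open>X t \<omega>\<close>.\<close>

text \<open>The second disjunct admits degenerate (almost surely constant) Gaussian variables, such as
  fractional Brownian motion at time 0.\<close>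

definition gaussian_rv :: "'a measure \<Rightarrow> ('a \<Rightarrow> real) \<Rightarrow> bool" where
  "gaussian_rv P X \<longleftrightarrow> X \<in> borel_measurable P \<and>
     ((\<exists>\<mu> s. s > 0 \<and> distributed P lborel X (normal_density \<mu> s)) \<or>
      (\<exists>\<mu>. AE \<omega> in P. X \<omega> = \<mu>))"

definition gaussian_process :: "'a measure \<Rightarrow> (real \<Rightarrow> 'a \<Rightarrow> real) \<Rightarrow> bool" where
  "gaussian_process P X \<longleftrightarrow>
     (\<forall>J c. finite J \<longrightarrow> gaussian_rv P (\<lambda>\<omega>. \<Sum>t\<in>J. c t * X t \<omega>))"

definition continuous_paths :: "'a measure \<Rightarrow> (real \<Rightarrow> 'a \<Rightarrow> real) \<Rightarrow> bool" where
  "continuous_paths P X \<longleftrightarrow> (\<forall>\<omega>\<in>space P. continuous_on UNIV (\<lambda>t. X t \<omega>))"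

definition fractional_brownian_motion ::
    "'a measure \<Rightarrow> real \<Rightarrow> (real \<Rightarrow> 'a \<Rightarrow> real) \<Rightarrow> bool" where
  "fractional_brownian_motion P H X \<longleftrightarrow>
     0 < H \<and> H < 1 \<and>
     gaussian_process P X \<and> continuous_paths P X \<and>
     (\<forall>t. (LINT \<omega>|P. X t \<omega>) = 0) \<and>
     (\<forall>t s. (LINT \<omega>|P. X t \<omega> * X s \<omega>)
        = 1/2 * (\<bar>t\<bar> powr (2*H) + \<bar>s\<bar> powr (2*H) - \<bar>t - s\<bar> powr (2*H)))"

text \<open>Independence of processes is independence of the random paths, as random elements of
  \<open>real \<Rightarrow> real\<close> with the product \<open>\<sigma>\<close>-algebra.\<close>

definition independent_processes :: "'a measure \<Rightarrow> ('i \<Rightarrow> real \<Rightarrow> 'a \<Rightarrow> real) \<Rightarrow> bool" where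
  "independent_processes P B \<longleftrightarrow>
     prob_space.indep_vars P (\<lambda>_. PiM UNIV (\<lambda>_. borel)) (\<lambda>i \<omega> t. B i t \<omega>) UNIV"

text \<open>Components are indexed by \<open>k = 0, 1, 2, \<dots>\<close>. The third conjunct under the quantifier over
  \<open>B\<close> is convergence of the series in \<open>L\<^sup>2\<close> for each time; continuity of paths selects the
  continuous version.\<close>

definition multi_mixed_fbm ::
    "'a measure \<Rightarrow> (nat \<Rightarrow> real) \<Rightarrow> (nat \<Rightarrow> real) \<Rightarrow> (real \<Rightarrow> 'a \<Rightarrow> real) \<Rightarrow> bool" where
  "multi_mixed_fbm P \<sigma> H M \<longleftrightarrow>
     (\<forall>t. M t \<in> borel_measurable P) \<and> continuous_paths P M \<and>
     (\<exists>B. (\<forall>k. fractional_brownian_motion P (H k) (B k)) \<and>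
          independent_processes P B \<and>
          (\<forall>t. (\<lambda>n. \<integral>\<^sup>+\<omega>. ennreal ((M t \<omega> - (\<Sum>k<n. \<sigma> k * B k t \<omega>))\<^sup>2) \<partial>P)
                 \<longlonglongrightarrow> 0))"

text \<open>The integral is the pathwise one obtained from \<open>\<integral> exp (- \<lambda> (t - s)) dM\<^sub>s\<close> by integration by
  parts; it converges for almost every \<open>\<omega>\<close>, and takes the value 0 where it does not.\<close>

definition ornstein_uhlenbeck ::
    "real \<Rightarrow> (real \<Rightarrow> 'a \<Rightarrow> real) \<Rightarrow> real \<Rightarrow> 'a \<Rightarrow> real" where
  "ornstein_uhlenbeck l M t \<omega> =
     M t \<omega> - l * (LINT s:{..t}|lborel. exp (- l * (t - s)) * M s \<omega>)"

definition covariance_stationary :: "'a measure \<Rightarrow> (real \<Rightarrow> 'a \<Rightarrow> real) \<Rightarrow> bool" where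
  "covariance_stationary P X \<longleftrightarrow>
     (\<forall>t. X t \<in> borel_measurable P \<and> integrable P (\<lambda>\<omega>. (X t \<omega>)\<^sup>2)) \<and>
     (\<forall>s t. (LINT \<omega>|P. X s \<omega>) = (LINT \<omega>|P. X t \<omega>)) \<and>
     (\<forall>s t h. (LINT \<omega>|P. X (s + h) \<omega> * X (t + h) \<omega>) = (LINT \<omega>|P. X s \<omega> * X t \<omega>))"

text \<open>For a covariance-stationary process the time origin 0 may be replaced by any other time.\<close>

definition autocovariance :: "'a measure \<Rightarrow> (real \<Rightarrow> 'a \<Rightarrow> real) \<Rightarrow> real \<Rightarrow> real" where
  "autocovariance P X t =
     (LINT \<omega>|P. (X 0 \<omega> - (LINT \<eta>|P. X 0 \<eta>)) * (X t \<omega> - (LINT \<eta>|P. X t \<eta>)))"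

definition long_range_dependent :: "'a measure \<Rightarrow> (real \<Rightarrow> 'a \<Rightarrow> real) \<Rightarrow> bool" where
  "long_range_dependent P X \<longleftrightarrow> covariance_stationary P X \<and>
     (\<exists>t0>0. (\<integral>\<^sup>+t\<in>{t0..}. ennreal \<bar>autocovariance P X t\<bar> \<partial>lborel) = \<infinity>)"

end

theory Submission
  imports Defs "HOL-Real_Asymp.Real_Asymp"
begin

text \<open>
  Substituting \<open>s = t - x\<close> gives \<open>U\<^sub>t = \<integral> (M\<^sub>t - M\<^bsub>t-x\<^esub>) d\<mu>(x)\<close>, where \<open>\<mu>\<close> is the exponential
  distribution with rate \<open>\<lambda>\<close>. Since \<open>M\<close> has stationary increments with variogram
  \<open>g(x) = \<Sum>\<^sub>k \<sigma>\<^sub>k\<^sup>2 |x| powr (2H\<^sub>k)\<close>, Fubini's theorem yields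
  \<open>\<rho>(t) = 1/2 E[g(t + X) + g(t - Y) - g(t) - g(t + X - Y)]\<close> for independent \<open>X\<close>, \<open>Y\<close> with
  law \<open>\<mu>\<close>. The functional \<open>f \<mapsto> E[f(X) + f(-Y) - f(0) - f(X - Y)]\<close> maps \<open>z\<^sup>j\<close> to \<open>j!/\<lambda>\<^sup>j\<close> if
  \<open>j > 0\<close> is even and to 0 otherwise, so the expansion of \<open>\<rho>\<close> is the Taylor expansion of \<open>g\<close> at
  \<open>t\<close>. By scaling, the Taylor remainder of order \<open>m\<close> of \<open>|t + z| powr a\<close> is at most
  \<open>C (t powr (a - m)) |z|\<^sup>m\<close> for all real \<open>z\<close>, even beyond the singularity at \<open>z = -t\<close>, with
  \<open>C\<close> uniform in \<open>0 \<le> a \<le> 2\<close>; hence neither the sum over \<open>k\<close> nor the expectation needs a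
  truncation.

  For the dichotomy, the leading coefficient of the \<open>k\<close>-th component is proportional to
  \<open>H\<^sub>k (2H\<^sub>k - 1)\<close>. If all \<open>H\<^sub>k \<le> 1/2\<close>, the factor \<open>2H\<^sub>k - 1\<close> cancels the divergence of
  \<open>\<integral> t powr (2H\<^sub>k - 2) dt\<close> as \<open>H\<^sub>k\<close> approaches \<open>1/2\<close>; if some \<open>H\<^sub>k > 1/2\<close>, its term
  dominates \<open>1/t\<close>, which in turn bounds all negative terms.
\<close>

section \<open>Uniform Taylor remainder of powers\<close>

text \<open>Consecutive coefficients have ratio \<open>\<bar>a - j\<bar> / (j + 1)\<close>, which is
  at most \<open>(j + 2) / (j + 1)\<close> uniformly in a, and these bounds telescope. Linear growth
  is enough against a geometric series.\<close>

lemma abs_gbinomial_le: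
  fixes a :: real
  assumes "0 \<le> a" "a \<le> 2"
  shows "\<bar>a gchoose j\<bar> \<le> real j + 1"
proof (induction j)
  case (Suc j)
  have "\<bar>a gchoose Suc j\<bar> = \<bar>a gchoose j\<bar> * (\<bar>a - real j\<bar> / (real j + 1))"
    by (simp add: gbinomial_prod_rev abs_mult abs_divide add.commute)
  also have "\<dots> \<le> (real j + 1) * ((real j + 2) / (real j + 1))"
    using assms by (intro mult_mono Suc.IH divide_right_mono) auto
  also have "\<dots> = real (Suc j) + 1"
    by (simp add: field_simps)
  finally show ?case .
qed simp

lemma summable_linear_geometric: "summable (\<lambda>i. (real i + real m + 1) * (1/2) ^ i)"
proof -
  have "summable (\<lambda>i. real (Suc i) * (1/2) ^ i)" "summable (\<lambda>i. (1/2 :: real) ^ i)"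
    using sums_summable[OF geometric_deriv_sums[of "1/2 :: real"]] by (auto intro: summable_geometric)
  from summable_add[OF this(1) summable_mult[OF this(2), of "real m"]] show ?thesis
    by (simp add: algebra_simps)
qed

text \<open>The remainder is the tail of the binomial series: \<open>\<bar>y\<bar> ^ m\<close> is
  pulled out and the remaining powers are bounded by those of 1/2, so the constant does not involve
  a.\<close>

lemma binomial_remainder_small:
  fixes a y :: real
  assumes a: "0 \<le> a" "a \<le> 2" and y: "\<bar>y\<bar> \<le> 1/2"
  shows "\<bar>(1 + y) powr a - (\<Sum>j<m. (a gchoose j) * y ^ j)\<bar>
           \<le> (\<Sum>i. (real i + real m + 1) * (1/2) ^ i) * \<bar>y\<bar> ^ m"
proof -
  have "(\<lambda>n. (a gchoose n) * y ^ n) sums (1 + y) powr a"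
    using y by (intro gen_binomial_real) auto
  then have "(\<lambda>i. (a gchoose (i + m)) * y ^ (i + m)) sums
      ((1 + y) powr a - (\<Sum>j<m. (a gchoose j) * y ^ j))"
    by (subst sums_iff_shift')
  then have eq: "(1 + y) powr a - (\<Sum>j<m. (a gchoose j) * y ^ j) =
      (\<Sum>i. (a gchoose (i + m)) * y ^ (i + m))"
    by (rule sums_unique)
  have le: "norm ((a gchoose (i + m)) * y ^ (i + m)) \<le> (real i + real m + 1) * (1/2) ^ i * \<bar>y\<bar> ^ m" for i
  proof -
    have "norm ((a gchoose (i + m)) * y ^ (i + m)) = \<bar>a gchoose (i + m)\<bar> * (\<bar>y\<bar> ^ i * \<bar>y\<bar> ^ m)"
      by (simp add: abs_mult power_abs power_add)
    also have "\<dots> \<le> (real i + real m + 1) * ((1/2) ^ i * \<bar>y\<bar> ^ m)"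
      using abs_gbinomial_le[OF a, of "i + m"] power_mono[OF y, of i]
      by (intro mult_mono[of "\<bar>a gchoose (i + m)\<bar>"] mult_right_mono[of "\<bar>y\<bar> ^ i"]) auto
    finally show ?thesis by (simp add: mult_ac)
  qed
  have s: "summable (\<lambda>i. (real i + real m + 1) * (1/2) ^ i * \<bar>y\<bar> ^ m)"
    by (intro summable_mult2 summable_linear_geometric)
  have "norm (\<Sum>i. (a gchoose (i + m)) * y ^ (i + m)) \<le> (\<Sum>i. (real i + real m + 1) * (1/2) ^ i * \<bar>y\<bar> ^ m)"
    by (rule norm_suminf_le[OF le s])
  also have "\<dots> = (\<Sum>i. (real i + real m + 1) * (1/2) ^ i) * \<bar>y\<bar> ^ m"
    by (intro suminf_mult2[symmetric] summable_linear_geometric)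
  finally show ?thesis
    using eq by simp
qed

text \<open>Away from 0 no cancellation is used: the power and the polynomial are separately bounded
  by multiples of \<open>\<bar>y\<bar> ^ m\<close>, so the singularity at y = -1 is harmless. The
  power grows at most quadratically, whence m is at least 2.\<close>

lemma binomial_remainder_large:
  fixes a y :: real
  assumes a: "0 \<le> a" "a \<le> 2" and y: "1/2 \<le> \<bar>y\<bar>" and m: "2 \<le> m"
  shows "\<bar>\<bar>1 + y\<bar> powr a - (\<Sum>j<m. (a gchoose j) * y ^ j)\<bar>
           \<le> (9 * 2 ^ (m - 2) + (\<Sum>j<m. (real j + 1) * 2 ^ (m - j))) * \<bar>y\<bar> ^ m"
proof -
  \<comment> \<open>Since \<open>2 * \<bar>y\<bar>\<close> is at least 1, a lower power is absorbed
    into the m-th one at the price of powers of 2.\<close>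
  have pow: "\<bar>y\<bar> ^ j \<le> 2 ^ (m - j) * \<bar>y\<bar> ^ m" if "j \<le> m" for j
  proof -
    have "1 \<le> (2 * \<bar>y\<bar>) ^ (m - j)"
      using y by (intro one_le_power) auto
    then have "\<bar>y\<bar> ^ j * 1 \<le> \<bar>y\<bar> ^ j * (2 * \<bar>y\<bar>) ^ (m - j)"
      by (intro mult_left_mono) auto
    also have "\<dots> = 2 ^ (m - j) * (\<bar>y\<bar> ^ j * \<bar>y\<bar> ^ (m - j))"
      by (simp add: power_mult_distrib mult_ac)
    also have "\<bar>y\<bar> ^ j * \<bar>y\<bar> ^ (m - j) = \<bar>y\<bar> ^ m"
      using that by (simp flip: power_add)
    finally show ?thesis by simp
  qed
  have "\<bar>1 + y\<bar> powr a \<le> (1 + \<bar>y\<bar>) powr a"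
    using a by (intro powr_mono2) auto
  also have "\<dots> \<le> (1 + \<bar>y\<bar>) powr 2"
    using a by (intro powr_mono) auto
  also have "\<dots> = (1 + \<bar>y\<bar>) ^ 2"
    by (simp add: powr_numeral)
  \<comment> \<open>Here 1 is replaced by \<open>2 * \<bar>y\<bar>\<close>.\<close>
  also have "\<dots> \<le> (3 * \<bar>y\<bar>) ^ 2"
    using y by (intro power_mono) auto
  also have "\<dots> = 9 * \<bar>y\<bar> ^ 2"
    by (simp add: power_mult_distrib)
  also have "\<dots> \<le> 9 * (2 ^ (m - 2) * \<bar>y\<bar> ^ m)"
    by (intro mult_left_mono pow m) auto
  finally have 1: "\<bar>1 + y\<bar> powr a \<le> 9 * 2 ^ (m - 2) * \<bar>y\<bar> ^ m" by simp
  have "\<bar>\<Sum>j<m. (a gchoose j) * y ^ j\<bar> \<le> (\<Sum>j<m. \<bar>(a gchoose j) * y ^ j\<bar>)"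
    by (rule sum_abs)
  also have "\<dots> \<le> (\<Sum>j<m. (real j + 1) * (2 ^ (m - j) * \<bar>y\<bar> ^ m))"
    unfolding abs_mult power_abs
    by (intro sum_mono mult_mono abs_gbinomial_le a pow) auto
  also have "\<dots> = (\<Sum>j<m. (real j + 1) * 2 ^ (m - j)) * \<bar>y\<bar> ^ m"
    by (simp only: sum_distrib_right mult.assoc)
  finally have 2: "\<bar>\<Sum>j<m. (a gchoose j) * y ^ j\<bar> \<le> \<dots>" .
  have "\<bar>\<bar>1 + y\<bar> powr a - (\<Sum>j<m. (a gchoose j) * y ^ j)\<bar>
      \<le> \<bar>1 + y\<bar> powr a + \<bar>\<Sum>j<m. (a gchoose j) * y ^ j\<bar>"
    using abs_triangle_ineq4[of "\<bar>1 + y\<bar> powr a" "\<Sum>j<m. (a gchoose j) * y ^ j"] by simp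
  then show ?thesis
    using 1 2 unfolding distrib_right by linarith
qed

lemma binomial_remainder:
  assumes "2 \<le> m"
  obtains C :: real where "0 \<le> C"
    "\<And>a y. 0 \<le> a \<Longrightarrow> a \<le> 2 \<Longrightarrow>
       \<bar>\<bar>1 + y\<bar> powr a - (\<Sum>j<m. (a gchoose j) * y ^ j)\<bar> \<le> C * \<bar>y\<bar> ^ m"
proof
  let ?A = "\<Sum>i. (real i + real m + 1) * (1/2) ^ i"
  let ?B = "9 * 2 ^ (m - 2) + (\<Sum>j<m. (real j + 1) * 2 ^ (m - j))"
  show "0 \<le> max ?A ?B"
    by (intro max.coboundedI2 add_nonneg_nonneg sum_nonneg) auto
  fix a y :: real
  assume a: "0 \<le> a" "a \<le> 2"
  show "\<bar>\<bar>1 + y\<bar> powr a - (\<Sum>j<m. (a gchoose j) * y ^ j)\<bar> \<le> max ?A ?B * \<bar>y\<bar> ^ m"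
  proof (cases "\<bar>y\<bar> \<le> 1/2")
    case True
    then have "\<bar>1 + y\<bar> = 1 + y" by simp
    then have "\<bar>\<bar>1 + y\<bar> powr a - (\<Sum>j<m. (a gchoose j) * y ^ j)\<bar> \<le> ?A * \<bar>y\<bar> ^ m"
      using binomial_remainder_small[OF a True] by simp
    also have "\<dots> \<le> max ?A ?B * \<bar>y\<bar> ^ m"
      by (intro mult_right_mono) auto
    finally show ?thesis .
  next
    case False
    then have "\<bar>\<bar>1 + y\<bar> powr a - (\<Sum>j<m. (a gchoose j) * y ^ j)\<bar> \<le> ?B * \<bar>y\<bar> ^ m"
      using binomial_remainder_large[OF a _ assms] by simp
    also have "\<dots> \<le> max ?A ?B * \<bar>y\<bar> ^ m"
      by (intro mult_right_mono) auto
    finally show ?thesis .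
  qed
qed

text \<open>The absolute value is kept on the right so that the result matches the summands of
  \<open>variogram\<close>.\<close>

lemma powr_diff_nat:
  fixes t a :: real
  shows "0 < t \<Longrightarrow> t powr (a - real j) = \<bar>t\<bar> powr a / t ^ j"
  by (simp add: powr_diff powr_realpow)

text \<open>Both sides are homogeneous in (t, z) of degree a, so the constant for t = 1 serves every
  positive t.\<close>

lemma abs_powr_remainder:
  assumes "2 \<le> m"
  obtains C :: real where "0 \<le> C"
    "\<And>a t z. 0 \<le> a \<Longrightarrow> a \<le> 2 \<Longrightarrow> 0 < t \<Longrightarrow>
       \<bar>\<bar>t + z\<bar> powr a - (\<Sum>j<m. (a gchoose j) * t powr (a - real j) * z ^ j)\<bar>
         \<le> C * t powr (a - real m) * \<bar>z\<bar> ^ m"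
proof -
  obtain C :: real where C: "0 \<le> C"
    "\<And>a y. 0 \<le> a \<Longrightarrow> a \<le> 2 \<Longrightarrow>
       \<bar>\<bar>1 + y\<bar> powr a - (\<Sum>j<m. (a gchoose j) * y ^ j)\<bar> \<le> C * \<bar>y\<bar> ^ m"
    using binomial_remainder[OF assms] by metis
  show thesis
  proof (rule that[OF C(1)])
    fix a t z :: real
    assume a: "0 \<le> a" "a \<le> 2" and t: "0 < t"
    have scale: "t powr (a - real j) * x = t powr a * (x / t ^ j)" for j x
      using t by (simp add: powr_diff powr_realpow)
    have "t + z = t * (1 + z / t)"
      using t by (simp add: field_simps)
    then have "\<bar>t + z\<bar> = t * \<bar>1 + z / t\<bar>"
      using t by (metis abs_mult abs_of_pos)
    then have 1: "\<bar>t + z\<bar> powr a = t powr a * \<bar>1 + z / t\<bar> powr a"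
      using t by (simp add: powr_mult)
    have 2: "(\<Sum>j<m. (a gchoose j) * t powr (a - real j) * z ^ j) =
        t powr a * (\<Sum>j<m. (a gchoose j) * (z / t) ^ j)"
      unfolding mult.assoc scale by (simp add: sum_distrib_left power_divide mult_ac)
    have "\<bar>\<bar>t + z\<bar> powr a - (\<Sum>j<m. (a gchoose j) * t powr (a - real j) * z ^ j)\<bar> =
        t powr a * \<bar>\<bar>1 + z / t\<bar> powr a - (\<Sum>j<m. (a gchoose j) * (z / t) ^ j)\<bar>"
      unfolding 1 2 right_diff_distrib[symmetric] abs_mult by simp
    also have "\<dots> \<le> t powr a * (C * \<bar>z / t\<bar> ^ m)"
      by (intro mult_left_mono C(2) a) auto
    also have "\<dots> = C * t powr (a - real m) * \<bar>z\<bar> ^ m"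
      unfolding mult.assoc scale using t by (simp add: power_divide)
    finally show "\<bar>\<bar>t + z\<bar> powr a - (\<Sum>j<m. (a gchoose j) * t powr (a - real j) * z ^ j)\<bar>
         \<le> C * t powr (a - real m) * \<bar>z\<bar> ^ m" .
  qed
qed

section \<open>Exponential second differences\<close>

text \<open>The Ornstein-Uhlenbeck kernel together with its prefactor has total mass one. Packing it
  into a measure turns the memory integral into an expectation.\<close>

definition expo :: "real \<Rightarrow> real measure" where
  "expo l = density lborel (exponential_density l)"

lemma sets_expo [simp, measurable_cong]: "sets (expo l) = sets borel"
  by (simp add: expo_def)

lemma space_expo [simp]: "space (expo l) = UNIV"
  by (simp add: expo_def)

lemma prob_space_expo: "0 < l \<Longrightarrow> prob_space (expo l)"
  unfolding expo_def by (rule prob_space_exponential_density)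

lemma has_bochner_integral_expo_power:
  assumes l: "0 < l"
  shows "has_bochner_integral (expo l) (\<lambda>x. x ^ n) (fact n / l ^ n)"
proof -
  have "has_bochner_integral lborel (\<lambda>x. exponential_density l x * x ^ n) (fact n / l ^ n)"
  proof (rule has_bochner_integral_nn_integral)
    show "AE x in lborel. 0 \<le> exponential_density l x * x ^ n"
      using l by (auto simp: erlang_density_def)
    show "(\<integral>\<^sup>+x. ennreal (exponential_density l x * x ^ n) \<partial>lborel) = ennreal (fact n / l ^ n)"
      \<comment> \<open>The exponential law is the Erlang law with index 0.\<close>
      using nn_integral_erlang_ith_moment[OF l, of 0 n] by simp
  qed (use l in auto)
  then show ?thesis
    unfolding expo_def using l by (intro has_bochner_integral_density) auto
qed

lemma integrable_expo_power [simp]: "0 < l \<Longrightarrow> integrable (expo l) (\<lambda>x. x ^ n)"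
  by (rule integrable.intros[OF has_bochner_integral_expo_power])

lemma integral_expo_power: "0 < l \<Longrightarrow> (LINT x|expo l. x ^ n) = fact n / l ^ n"
  by (rule has_bochner_integral_integral_eq[OF has_bochner_integral_expo_power])

lemma pair_prob_space_expo: "0 < l \<Longrightarrow> pair_prob_space (expo l) (expo l)"
  by (intro pair_prob_space.intro pair_sigma_finite.intro prob_space_expo prob_space_imp_sigma_finite)

lemma integrable_expo_pair_power:
  assumes l: "0 < l"
  shows "integrable (expo l \<Otimes>\<^sub>M expo l) (\<lambda>q. fst q ^ i * snd q ^ j)"
proof -
  interpret pair_prob_space "expo l" "expo l" by (rule pair_prob_space_expo[OF l])
  have "integrable (expo l) (\<lambda>x. \<bar>x ^ i\<bar>)" for i
    by (intro integrable_abs integrable_expo_power l)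
  then show ?thesis
    by (intro Fubini_integrable) (auto simp: abs_mult l)
qed

lemma integral_expo_pair_power:
  assumes l: "0 < l"
  shows "(LINT q|(expo l \<Otimes>\<^sub>M expo l). fst q ^ i * snd q ^ j) = fact i * fact j / l ^ (i + j)"
proof -
  interpret pair_prob_space "expo l" "expo l" by (rule pair_prob_space_expo[OF l])
  show ?thesis
    using integral_fst'[OF integrable_expo_pair_power[OF l, of i j]]
    by (simp add: integral_expo_power[OF l] power_add mult.commute)
qed

text \<open>With (X, Y) for the pair q, the integrand is minus the mixed second difference of f at 0
  with steps X and -Y. Constant and linear parts of f therefore cancel pointwise.\<close>

definition exp_second_difference :: "real \<Rightarrow> (real \<Rightarrow> real) \<Rightarrow> real" where
  "exp_second_difference l f =
     (LINT q|(expo l \<Otimes>\<^sub>M expo l). f (fst q) + f (- snd q) - f 0 - f (fst q - snd q))"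

lemma binomial_term_fact:
  assumes "i \<le> j"
  shows "real (j choose i) * (fact i * fact (j - i)) = fact j"
  by (simp add: binomial_fact[OF assms])

lemma alternating_sum_atMost: "(\<Sum>i\<le>j. (- 1) ^ (j - i) :: real) = (if even j then 1 else 0)"
proof -
  have "(\<Sum>i\<le>j. (- 1) ^ (j - i) :: real) = (\<Sum>i\<le>j. (- 1) ^ i)"
    by (rule sum.reindex_bij_witness[of _ "\<lambda>i. j - i" "\<lambda>i. j - i"]) auto
  also have "\<dots> = (if even j then 1 else 0)"
    by (induction j) auto
  finally show ?thesis .
qed

text \<open>The factorial moments cancel the binomial coefficients and leave
  \<open>fact j / l ^ j\<close> times an alternating sum of signs. These are the moments of a
  symmetric Laplace law.\<close>

lemma expo_difference_power:
  assumes l: "0 < l"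
  shows "has_bochner_integral (expo l \<Otimes>\<^sub>M expo l) (\<lambda>q. (fst q - snd q) ^ j)
           (if even j then fact j / l ^ j else 0)"
proof -
  have eq: "(\<lambda>q::real \<times> real. (fst q - snd q) ^ j) =
      (\<lambda>q. \<Sum>i\<le>j. (real (j choose i) * (- 1) ^ (j - i)) * (fst q ^ i * snd q ^ (j - i)))"
  proof
    fix q :: "real \<times> real"
    have "(fst q - snd q) ^ j = (fst q + - snd q) ^ j" by simp
    also have "\<dots> = (\<Sum>i\<le>j. real (j choose i) * fst q ^ i * (- snd q) ^ (j - i))"
      by (rule binomial_ring)
    also have "\<dots> = (\<Sum>i\<le>j. (real (j choose i) * (- 1) ^ (j - i)) * (fst q ^ i * snd q ^ (j - i)))"
      by (intro sum.cong refl) (subst power_minus, simp)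
    finally show "(fst q - snd q) ^ j = \<dots>" .
  qed
  have hb: "has_bochner_integral (expo l \<Otimes>\<^sub>M expo l) (\<lambda>q. fst q ^ i * snd q ^ k)
      (fact i * fact k / l ^ (i + k))" for i k
    using has_bochner_integral_integrable[OF integrable_expo_pair_power[OF l]]
    unfolding integral_expo_pair_power[OF l] .
  have "has_bochner_integral (expo l \<Otimes>\<^sub>M expo l) (\<lambda>q. (fst q - snd q) ^ j)
      (\<Sum>i\<le>j. (real (j choose i) * (- 1) ^ (j - i)) * (fact i * fact (j - i) / l ^ (i + (j - i))))"
    unfolding eq by (intro has_bochner_integral_sum has_bochner_integral_mult_right hb)
  also have "(\<Sum>i\<le>j. (real (j choose i) * (- 1) ^ (j - i)) * (fact i * fact (j - i) / l ^ (i + (j - i))))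
      = (\<Sum>i\<le>j. (- 1) ^ (j - i) * (fact j / l ^ j))"
  proof (intro sum.cong refl)
    fix i assume "i \<in> {..j}"
    then have ij: "i \<le> j" by simp
    show "(real (j choose i) * (- 1) ^ (j - i)) * (fact i * fact (j - i) / l ^ (i + (j - i)))
        = (- 1) ^ (j - i) * (fact j / l ^ j)"
      using ij by (simp add: mult_ac flip: binomial_term_fact[OF ij])
  qed
  also have "\<dots> = (if even j then fact j / l ^ j else 0)"
    unfolding sum_distrib_right[symmetric] alternating_sum_atMost by simp
  finally show ?thesis .
qed

text \<open>For even positive j the two single moments count twice and the moment of the difference
  removes one copy; for odd j the single moments cancel each other.\<close>

lemma second_difference_power:
  assumes l: "0 < l"
  shows "has_bochner_integral (expo l \<Otimes>\<^sub>M expo l)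
           (\<lambda>q. fst q ^ j + (- snd q) ^ j - 0 ^ j - (fst q - snd q) ^ j)
           (if even j \<and> 0 < j then fact j / l ^ j else 0)"
proof -
  interpret pair_prob_space "expo l" "expo l" by (rule pair_prob_space_expo[OF l])
  have hb: "has_bochner_integral (expo l \<Otimes>\<^sub>M expo l) (\<lambda>q. fst q ^ i * snd q ^ k)
      (fact i * fact k / l ^ (i + k))" for i k
    using has_bochner_integral_integrable[OF integrable_expo_pair_power[OF l]]
    unfolding integral_expo_pair_power[OF l] .
  \<comment> \<open>Since \<open>0 ^ 0\<close> is 1, this term makes the total vanish for j = 0; for
    positive j it is 0.\<close>
  have "has_bochner_integral (expo l \<Otimes>\<^sub>M expo l) (\<lambda>q. 0 ^ j :: real) (0 ^ j)"
    by (simp add: has_bochner_integral_iff P.prob_space)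
  moreover have "has_bochner_integral (expo l \<Otimes>\<^sub>M expo l) (\<lambda>q. fst q ^ j) (fact j / l ^ j)"
    using hb[of j 0] by simp
  moreover have "has_bochner_integral (expo l \<Otimes>\<^sub>M expo l) (\<lambda>q. (- snd q) ^ j) ((- 1) ^ j * (fact j / l ^ j))"
    using has_bochner_integral_mult_right[OF hb[of 0 j], of "(- 1) ^ j"] by (simp add: power_minus[of "snd _"])
  ultimately have "has_bochner_integral (expo l \<Otimes>\<^sub>M expo l)
      (\<lambda>q. fst q ^ j + (- snd q) ^ j - 0 ^ j - (fst q - snd q) ^ j)
      (fact j / l ^ j + (- 1) ^ j * (fact j / l ^ j) - 0 ^ j - (if even j then fact j / l ^ j else 0))"
    by (intro has_bochner_integral_diff has_bochner_integral_add expo_difference_power l)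
  also have "fact j / l ^ j + (- 1) ^ j * (fact j / l ^ j) - 0 ^ j - (if even j then fact j / l ^ j else 0)
      = (if even j \<and> 0 < j then fact j / l ^ j else 0)"
    by (cases "j = 0") auto
  finally show ?thesis .
qed

text \<open>Among the degrees below 2N+2 only 2, 4, ..., 2N survive. The odd degree 2N+1 can be
  included at no cost, which is why the error term gains two orders.\<close>

lemma second_difference_polynomial:
  assumes l: "0 < l"
  shows "has_bochner_integral (expo l \<Otimes>\<^sub>M expo l)
           (\<lambda>q. \<Sum>j<2*N+2. c j * (fst q ^ j + (- snd q) ^ j - 0 ^ j - (fst q - snd q) ^ j))
           (\<Sum>n=1..N. c (2*n) * (fact (2*n) / l ^ (2*n)))"
proof -
  have "has_bochner_integral (expo l \<Otimes>\<^sub>M expo l)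
      (\<lambda>q. \<Sum>j<2*N+2. c j * (fst q ^ j + (- snd q) ^ j - 0 ^ j - (fst q - snd q) ^ j))
      (\<Sum>j<2*N+2. c j * (if even j \<and> 0 < j then fact j / l ^ j else 0))"
    by (intro has_bochner_integral_sum has_bochner_integral_mult_right second_difference_power l)
  also have "(\<Sum>j<2*N+2. c j * (if even j \<and> 0 < j then fact j / l ^ j else 0)) =
      (\<Sum>j\<in>(\<lambda>n. 2 * n) ` {1..N}. c j * (fact j / l ^ j))"
  proof (rule sum.mono_neutral_cong_right)
    show "\<forall>i\<in>{..<2*N+2} - (\<lambda>n. 2 * n) ` {1..N}. c i * (if even i \<and> 0 < i then fact i / l ^ i else 0) = 0"
      by (auto elim!: evenE simp: image_iff)
  qed auto
  also have "\<dots> = (\<Sum>n=1..N. c (2*n) * (fact (2*n) / l ^ (2*n)))"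
    by (subst sum.reindex) (auto simp: inj_on_def)
  finally show ?thesis .
qed

lemma integrable_expo_pair_abs_power:
  assumes l: "0 < l"
  shows "integrable (expo l \<Otimes>\<^sub>M expo l)
    (\<lambda>q. \<bar>fst q\<bar> ^ m + \<bar>snd q\<bar> ^ m + 0 ^ m + \<bar>fst q - snd q\<bar> ^ m)"
proof -
  interpret pair_prob_space "expo l" "expo l" by (rule pair_prob_space_expo[OF l])
  have "integrable (expo l \<Otimes>\<^sub>M expo l) (\<lambda>q. \<bar>fst q ^ m * snd q ^ 0\<bar>)"
       "integrable (expo l \<Otimes>\<^sub>M expo l) (\<lambda>q. \<bar>fst q ^ 0 * snd q ^ m\<bar>)"
       "integrable (expo l \<Otimes>\<^sub>M expo l) (\<lambda>q. \<bar>(fst q - snd q) ^ m\<bar>)"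
    by (intro integrable_abs integrable_expo_pair_power l
          integrable.intros[OF expo_difference_power])+
  then show ?thesis
    by (intro Bochner_Integration.integrable_add) (simp_all add: power_abs)
qed

text \<open>The functional is exact on the polynomial part, and D is the integral of the m-th
  absolute powers at its four arguments. As D depends only on l and N, it can be used with f, c and
  K varying in t. Integrability follows from the pointwise bound.\<close>

lemma second_difference_expansion:
  assumes l: "0 < l"
  obtains D :: real where "0 \<le> D"
    "\<And>f c K. f \<in> borel_measurable borel \<Longrightarrow>
      (\<And>z. \<bar>f z - (\<Sum>j<2*N+2. c j * z ^ j)\<bar> \<le> K * \<bar>z\<bar> ^ (2*N+2)) \<Longrightarrow>
      \<bar>exp_second_difference l f - (\<Sum>n=1..N. c (2*n) * (fact (2*n) / l ^ (2*n)))\<bar> \<le> K * D"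
proof
  let ?m = "2*N+2"
  let ?Q = "expo l \<Otimes>\<^sub>M expo l"
  let ?d = "\<lambda>q::real \<times> real. \<bar>fst q\<bar> ^ ?m + \<bar>snd q\<bar> ^ ?m + 0 ^ ?m + \<bar>fst q - snd q\<bar> ^ ?m"
  let ?D = "LINT q|?Q. ?d q"
  note intd = integrable_expo_pair_abs_power[OF l, of ?m]
  show "0 \<le> ?D"
    by (intro integral_nonneg_AE) auto
  fix f :: "real \<Rightarrow> real" and c K
  assume f [measurable]: "f \<in> borel_measurable borel"
    and bd: "\<And>z. \<bar>f z - (\<Sum>j<?m. c j * z ^ j)\<bar> \<le> K * \<bar>z\<bar> ^ ?m"
  let ?e = "\<lambda>z. f z - (\<Sum>j<?m. c j * z ^ j)"
  let ?R = "\<lambda>q. ?e (fst q) + ?e (- snd q) - ?e 0 - ?e (fst q - snd q)"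
  let ?p = "\<lambda>q::real \<times> real. \<Sum>j<?m. c j * (fst q ^ j + (- snd q) ^ j - 0 ^ j - (fst q - snd q) ^ j)"
  have Rle: "\<bar>?R q\<bar> \<le> K * ?d q" for q
    using bd[of "fst q"] bd[of "- snd q"] bd[of 0] bd[of "fst q - snd q"]
    unfolding distrib_left abs_minus_cancel abs_zero by linarith
  have intR: "integrable ?Q ?R"
  proof (rule Bochner_Integration.integrable_bound)
    show "integrable ?Q (\<lambda>q. K * ?d q)"
      using intd by simp
    show "AE q in ?Q. norm (?R q) \<le> norm (K * ?d q)"
      unfolding real_norm_def by (intro AE_I2 order_trans[OF Rle abs_ge_self])
  qed measurable
  have "f (fst q) + f (- snd q) - f 0 - f (fst q - snd q) = ?R q + ?p q" for q
    by (simp add: algebra_simps sum.distrib sum_subtractf del: sum.lessThan_Suc)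
  then have "exp_second_difference l f = (LINT q|?Q. ?R q + ?p q)"
    by (simp only: exp_second_difference_def)
  also have "\<dots> = (LINT q|?Q. ?R q) + (LINT q|?Q. ?p q)"
    by (intro Bochner_Integration.integral_add intR integrable.intros[OF second_difference_polynomial[OF l]])
  also have "(LINT q|?Q. ?p q) = (\<Sum>n=1..N. c (2*n) * (fact (2*n) / l ^ (2*n)))"
    by (rule has_bochner_integral_integral_eq[OF second_difference_polynomial[OF l]])
  finally have "\<bar>exp_second_difference l f - (\<Sum>n=1..N. c (2*n) * (fact (2*n) / l ^ (2*n)))\<bar> = norm (LINT q|?Q. ?R q)"
    by simp
  also have "\<dots> \<le> (LINT q|?Q. K * ?d q)"
    by (rule Bochner_Integration.integral_norm_bound_integral[OF intR integrable_mult_right[OF intd]])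
       (simp only: real_norm_def Rle)
  also have "\<dots> = K * ?D"
    by simp
  finally show "\<bar>exp_second_difference l f - (\<Sum>n=1..N. c (2*n) * (fact (2*n) / l ^ (2*n)))\<bar> \<le> K * ?D" .
qed

section \<open>Square integrable functions\<close>

lemma square_integrable_mult:
  fixes f h :: "'a \<Rightarrow> real"
  assumes [measurable]: "f \<in> borel_measurable M" "h \<in> borel_measurable M"
    and "integrable M (\<lambda>x. (f x)\<^sup>2)" "integrable M (\<lambda>x. (h x)\<^sup>2)"
  shows "integrable M (\<lambda>x. f x * h x)"
proof (rule Bochner_Integration.integrable_bound)
  show "integrable M (\<lambda>x. (f x)\<^sup>2 + (h x)\<^sup>2)"
    using assms by simp
  have "\<bar>a * b\<bar> \<le> a\<^sup>2 + b\<^sup>2" for a b :: real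
    using sum_squares_bound[of "\<bar>a\<bar>" "\<bar>b\<bar>"] mult_nonneg_nonneg[of "\<bar>a\<bar>" "\<bar>b\<bar>"]
    unfolding abs_mult power2_abs by linarith
  then show "AE x in M. norm (f x * h x) \<le> norm ((f x)\<^sup>2 + (h x)\<^sup>2)"
    by (intro AE_I2) (simp only: real_norm_def abs_of_nonneg sum_power2_ge_zero)
qed measurable

lemma square_integrable_diff:
  fixes f h :: "'a \<Rightarrow> real"
  assumes [measurable]: "f \<in> borel_measurable M" "h \<in> borel_measurable M"
    and "integrable M (\<lambda>x. (f x)\<^sup>2)" "integrable M (\<lambda>x. (h x)\<^sup>2)"
  shows "integrable M (\<lambda>x. (f x - h x)\<^sup>2)"
  unfolding power2_diff
  using assms square_integrable_mult[OF assms] by (simp add: mult.assoc)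

lemma Cauchy_Schwarz_integral:
  fixes f h :: "'a \<Rightarrow> real"
  assumes [measurable]: "f \<in> borel_measurable M" "h \<in> borel_measurable M"
    and f: "integrable M (\<lambda>x. (f x)\<^sup>2)" and h: "integrable M (\<lambda>x. (h x)\<^sup>2)"
  shows "\<bar>LINT x|M. f x * h x\<bar> \<le> sqrt (LINT x|M. (f x)\<^sup>2) * sqrt (LINT x|M. (h x)\<^sup>2)"
proof -
  have fh: "integrable M (\<lambda>x. \<bar>f x * h x\<bar>)"
    by (intro integrable_abs square_integrable_mult assms)
  have "(\<integral>\<^sup>+x. ennreal \<bar>f x\<bar> * ennreal \<bar>h x\<bar> \<partial>M)\<^sup>2 \<le>
      (\<integral>\<^sup>+x. (ennreal \<bar>f x\<bar>)\<^sup>2 \<partial>M) * (\<integral>\<^sup>+x. (ennreal \<bar>h x\<bar>)\<^sup>2 \<partial>M)"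
    by (rule Cauchy_Schwarz_nn_integral) auto
  also have "(\<integral>\<^sup>+x. ennreal \<bar>f x\<bar> * ennreal \<bar>h x\<bar> \<partial>M) = ennreal (LINT x|M. \<bar>f x * h x\<bar>)"
    using fh by (subst nn_integral_eq_integral[symmetric]) (auto simp: abs_mult ennreal_mult)
  also have "(\<integral>\<^sup>+x. (ennreal \<bar>f x\<bar>)\<^sup>2 \<partial>M) = ennreal (LINT x|M. (f x)\<^sup>2)"
    using f by (subst nn_integral_eq_integral[symmetric]) (auto simp: ennreal_power)
  also have "(\<integral>\<^sup>+x. (ennreal \<bar>h x\<bar>)\<^sup>2 \<partial>M) = ennreal (LINT x|M. (h x)\<^sup>2)"
    using h by (subst nn_integral_eq_integral[symmetric]) (auto simp: ennreal_power)
  finally have "(LINT x|M. \<bar>f x * h x\<bar>)\<^sup>2 \<le> (LINT x|M. (f x)\<^sup>2) * (LINT x|M. (h x)\<^sup>2)"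
    by (simp add: ennreal_power ennreal_mult[symmetric] ennreal_le_iff)
  then have "(LINT x|M. \<bar>f x * h x\<bar>) \<le> sqrt ((LINT x|M. (f x)\<^sup>2) * (LINT x|M. (h x)\<^sup>2))"
    by (rule real_le_rsqrt)
  moreover have "\<bar>LINT x|M. f x * h x\<bar> \<le> (LINT x|M. \<bar>f x * h x\<bar>)"
    by (rule integral_abs_bound)
  ultimately show ?thesis
    unfolding real_sqrt_mult by linarith
qed

text \<open>The limit is stated for nonnegative integrals, so it also carries integrability: some
  error is finite, and X differs from that approximant by a square integrable function.\<close>

lemma square_integrable_L2_limit:
  fixes X :: "'a \<Rightarrow> real" and Xn :: "nat \<Rightarrow> 'a \<Rightarrow> real"
  assumes X [measurable]: "X \<in> borel_measurable M" and Xn [measurable]: "\<And>n. Xn n \<in> borel_measurable M"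
    and sq: "\<And>n. integrable M (\<lambda>x. (Xn n x)\<^sup>2)"
    and lim: "(\<lambda>n. \<integral>\<^sup>+x. ennreal ((X x - Xn n x)\<^sup>2) \<partial>M) \<longlonglongrightarrow> 0"
  shows "integrable M (\<lambda>x. (X x)\<^sup>2)" and "(\<lambda>n. LINT x|M. (X x - Xn n x)\<^sup>2) \<longlonglongrightarrow> 0"
proof -
  have "\<forall>\<^sub>F n in sequentially. (\<integral>\<^sup>+x. ennreal ((X x - Xn n x)\<^sup>2) \<partial>M) < \<infinity>"
    using lim by (rule order_tendstoD) simp
  then obtain n where "(\<integral>\<^sup>+x. ennreal ((X x - Xn n x)\<^sup>2) \<partial>M) < \<infinity>"
    by (auto simp: eventually_sequentially)
  then have "integrable M (\<lambda>x. (X x - Xn n x)\<^sup>2)"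
    by (intro integrableI_nonneg) auto
  then have "integrable M (\<lambda>x. (- (X x - Xn n x))\<^sup>2)" by (simp only: power2_minus)
  \<comment> \<open>X is written as a difference, with the negated error as subtrahend, to fit
    \<open>square_integrable_diff\<close>.\<close>
  then have "integrable M (\<lambda>x. (Xn n x - - (X x - Xn n x))\<^sup>2)"
    by (intro square_integrable_diff sq) auto
  then show int: "integrable M (\<lambda>x. (X x)\<^sup>2)" by simp
  have "(\<integral>\<^sup>+x. ennreal ((X x - Xn n x)\<^sup>2) \<partial>M) = ennreal (LINT x|M. (X x - Xn n x)\<^sup>2)" for n
    by (intro nn_integral_eq_integral square_integrable_diff X Xn int sq) auto
  then show "(\<lambda>n. LINT x|M. (X x - Xn n x)\<^sup>2) \<longlonglongrightarrow> 0"
    using lim by (simp add: tendsto_ennreal_iff[where x = 0, simplified])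
qed

text \<open>Continuity of the inner product: the error is expanded about the limits and
  Cauchy-Schwarz is applied to each piece.\<close>

lemma L2_limit_integral_mult:
  fixes X Y :: "'a \<Rightarrow> real" and Xn Yn :: "nat \<Rightarrow> 'a \<Rightarrow> real"
  assumes X [measurable]: "X \<in> borel_measurable M" "\<And>n. Xn n \<in> borel_measurable M"
    and Y [measurable]: "Y \<in> borel_measurable M" "\<And>n. Yn n \<in> borel_measurable M"
    and sqX: "\<And>n. integrable M (\<lambda>x. (Xn n x)\<^sup>2)" and sqY: "\<And>n. integrable M (\<lambda>x. (Yn n x)\<^sup>2)"
    and limX: "(\<lambda>n. \<integral>\<^sup>+x. ennreal ((X x - Xn n x)\<^sup>2) \<partial>M) \<longlonglongrightarrow> 0"
    and limY: "(\<lambda>n. \<integral>\<^sup>+x. ennreal ((Y x - Yn n x)\<^sup>2) \<partial>M) \<longlonglongrightarrow> 0"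
  shows "(\<lambda>n. LINT x|M. Xn n x * Yn n x) \<longlonglongrightarrow> (LINT x|M. X x * Y x)"
proof (rule Lim_null[THEN iffD2], rule tendsto_rabs_zero_cancel)
  let ?I = "\<lambda>f. LINT x|M. (f x)\<^sup>2"
  note iX = square_integrable_L2_limit[OF X sqX limX] and iY = square_integrable_L2_limit[OF Y sqY limY]
  have dX: "integrable M (\<lambda>x. (X x - Xn n x)\<^sup>2)" and dY: "integrable M (\<lambda>x. (Y x - Yn n x)\<^sup>2)" for n
    by (intro square_integrable_diff X Y iX iY sqX sqY)+
  \<comment> \<open>The three summands bound the error in X alone, the error in Y alone, and the
    product of the two errors.\<close>
  let ?b = "\<lambda>n. sqrt (?I (\<lambda>x. X x - Xn n x)) * sqrt (?I Y) + sqrt (?I X) * sqrt (?I (\<lambda>x. Y x - Yn n x))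
                + sqrt (?I (\<lambda>x. X x - Xn n x)) * sqrt (?I (\<lambda>x. Y x - Yn n x))"
  have "?b \<longlonglongrightarrow> sqrt 0 * sqrt (?I Y) + sqrt (?I X) * sqrt 0 + sqrt 0 * sqrt 0"
    by (intro tendsto_intros iX iY)
  then have lim: "?b \<longlonglongrightarrow> 0" by simp
  have le: "\<bar>(LINT x|M. Xn n x * Yn n x) - (LINT x|M. X x * Y x)\<bar> \<le> ?b n" for n
  proof -
    have i1: "integrable M (\<lambda>x. (X x - Xn n x) * Y x)" and i2: "integrable M (\<lambda>x. X x * (Y x - Yn n x))"
      and i3: "integrable M (\<lambda>x. (X x - Xn n x) * (Y x - Yn n x))"
      by (intro square_integrable_mult dX dY iX iY; measurable)+
    have "Xn n x * Yn n x = X x * Y x - (X x - Xn n x) * Y x - X x * (Y x - Yn n x)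
        + (X x - Xn n x) * (Y x - Yn n x)" for x
      by (simp add: algebra_simps)
    then have "(LINT x|M. Xn n x * Yn n x) = (LINT x|M. X x * Y x - (X x - Xn n x) * Y x
        - X x * (Y x - Yn n x) + (X x - Xn n x) * (Y x - Yn n x))"
      by (simp only:)
    also have "\<dots> = (LINT x|M. X x * Y x) - (LINT x|M. (X x - Xn n x) * Y x)
        - (LINT x|M. X x * (Y x - Yn n x)) + (LINT x|M. (X x - Xn n x) * (Y x - Yn n x))"
      using square_integrable_mult[OF X(1) Y(1) iX(1) iY(1)] i1 i2 i3
      by (simp only: Bochner_Integration.integral_add Bochner_Integration.integral_diff
          Bochner_Integration.integrable_add Bochner_Integration.integrable_diff)
    finally have "(LINT x|M. Xn n x * Yn n x) - (LINT x|M. X x * Y x) =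
        - (LINT x|M. (X x - Xn n x) * Y x) - (LINT x|M. X x * (Y x - Yn n x))
        + (LINT x|M. (X x - Xn n x) * (Y x - Yn n x))"
      by simp
    moreover have "\<bar>LINT x|M. (X x - Xn n x) * Y x\<bar> \<le> sqrt (?I (\<lambda>x. X x - Xn n x)) * sqrt (?I Y)"
      by (intro Cauchy_Schwarz_integral dX iY) measurable
    moreover have "\<bar>LINT x|M. X x * (Y x - Yn n x)\<bar> \<le> sqrt (?I X) * sqrt (?I (\<lambda>x. Y x - Yn n x))"
      by (intro Cauchy_Schwarz_integral dY iX) measurable
    moreover have "\<bar>LINT x|M. (X x - Xn n x) * (Y x - Yn n x)\<bar>
        \<le> sqrt (?I (\<lambda>x. X x - Xn n x)) * sqrt (?I (\<lambda>x. Y x - Yn n x))"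
      by (intro Cauchy_Schwarz_integral dX dY) measurable
    ultimately show ?thesis by linarith
  qed
  show "(\<lambda>n. \<bar>(LINT x|M. Xn n x * Yn n x) - (LINT x|M. X x * Y x)\<bar>) \<longlonglongrightarrow> 0"
    by (rule tendsto_sandwich[OF _ _ tendsto_const lim]) (use le in auto)
qed

lemma (in prob_space) gaussian_rv_square_integrable:
  assumes "gaussian_rv M X"
  shows "integrable M (\<lambda>\<omega>. (X \<omega>)\<^sup>2)"
proof -
  have X [measurable]: "X \<in> borel_measurable M"
    using assms by (simp add: gaussian_rv_def)
  consider \<mu> s where "s > 0" "distributed M lborel X (normal_density \<mu> s)"
    | \<mu> where "AE \<omega> in M. X \<omega> = \<mu>"
    using assms by (auto simp: gaussian_rv_def)
  then show ?thesis
  proof cases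
    case 1
    \<comment> \<open>The second moment about 0 is assembled from the centered one, the mean and the
      total mass.\<close>
    have "integrable lborel (\<lambda>x. normal_density \<mu> s x * (x - \<mu>) ^ 2)"
      using 1 by (intro integrable_normal_moment)
    moreover have "integrable lborel (\<lambda>x. normal_density \<mu> s x * x)"
      using 1 by (intro integrable_normal_moment_nz_1)
    moreover have "integrable lborel (normal_density \<mu> s)"
      using 1 by simp
    ultimately have "integrable lborel (\<lambda>x. normal_density \<mu> s x * (x - \<mu>) ^ 2
        + 2 * \<mu> * (normal_density \<mu> s x * x) - \<mu>\<^sup>2 * normal_density \<mu> s x)"
      by simp
    also have "(\<lambda>x. normal_density \<mu> s x * (x - \<mu>) ^ 2
        + 2 * \<mu> * (normal_density \<mu> s x * x) - \<mu>\<^sup>2 * normal_density \<mu> s x) = (\<lambda>x. normal_density \<mu> s x * x\<^sup>2)"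
      by (simp add: fun_eq_iff power2_eq_square algebra_simps)
    finally show ?thesis
      using distributed_integrable[OF 1(2), of "\<lambda>x. x\<^sup>2"] by simp
  next
    case 2
    have "integrable M (\<lambda>\<omega>. \<mu>\<^sup>2)" by simp
    then show ?thesis
      by (subst integrable_cong_AE[of _ _ "\<lambda>_. \<mu>\<^sup>2"]) (use 2 in auto)
  qed
qed

section \<open>Covariance of multi-mixed fractional Brownian motion\<close>

text \<open>The majorant is uniform in the exponent, so it survives summation over the components
  and is integrable against exponential weights.\<close>

lemma abs_powr_le_1_plus_square:
  fixes x a :: real
  assumes "0 \<le> a" "a \<le> 2"
  shows "\<bar>x\<bar> powr a \<le> 1 + x\<^sup>2"
proof (cases "\<bar>x\<bar> \<le> 1")
  case True
  then have "\<bar>x\<bar> powr a \<le> 1"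
    using assms by (intro powr_le1) auto
  then show ?thesis
    by (simp add: add_increasing2)
next
  case False
  then have "\<bar>x\<bar> powr a \<le> \<bar>x\<bar> powr 2"
    using assms by (intro powr_mono) auto
  then show ?thesis
    using False by (simp add: powr_numeral)
qed

definition variogram :: "(nat \<Rightarrow> real) \<Rightarrow> (nat \<Rightarrow> real) \<Rightarrow> real \<Rightarrow> real" where
  "variogram \<sigma> H x = (\<Sum>k. (\<sigma> k)\<^sup>2 * \<bar>x\<bar> powr (2 * H k))"

lemma variogram_minus: "variogram \<sigma> H (- x) = variogram \<sigma> H x"
  by (simp add: variogram_def)

text \<open>\<open>0 powr a\<close> is 0 for every a, so each summand vanishes.\<close>

lemma variogram_0 [simp]: "variogram \<sigma> H 0 = 0"
  by (simp add: variogram_def)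

lemma measurable_variogram [measurable]: "variogram \<sigma> H \<in> borel_measurable borel"
  unfolding variogram_def [abs_def] by measurable

locale mixed_fbm = prob_space P for P :: "'a measure" +
  fixes \<sigma> H :: "nat \<Rightarrow> real" and M :: "real \<Rightarrow> 'a \<Rightarrow> real"
  assumes summable_\<sigma>: "summable (\<lambda>k. (\<sigma> k)\<^sup>2)"
    and Hurst: "\<And>k. 0 < H k \<and> H k < 1"
    and mixed: "multi_mixed_fbm P \<sigma> H M"
begin

lemma summable_variogram: "summable (\<lambda>k. (\<sigma> k)\<^sup>2 * \<bar>x\<bar> powr (2 * H k))"
proof (rule summable_comparison_test')
  show "summable (\<lambda>k. (\<sigma> k)\<^sup>2 * (1 + x\<^sup>2))"
    by (intro summable_mult2 summable_\<sigma>)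
  show "norm ((\<sigma> k)\<^sup>2 * \<bar>x\<bar> powr (2 * H k)) \<le> (\<sigma> k)\<^sup>2 * (1 + x\<^sup>2)" for k
    using abs_powr_le_1_plus_square[of "2 * H k" x] Hurst[of k] by (simp add: abs_mult mult_left_mono)
qed

lemma variogram_sums: "(\<lambda>k. (\<sigma> k)\<^sup>2 * \<bar>x\<bar> powr (2 * H k)) sums variogram \<sigma> H x"
  unfolding variogram_def by (rule summable_sums[OF summable_variogram])

lemma variogram_le: "variogram \<sigma> H x \<le> (\<Sum>k. (\<sigma> k)\<^sup>2) * (1 + x\<^sup>2)"
proof -
  have "variogram \<sigma> H x \<le> (\<Sum>k. (\<sigma> k)\<^sup>2 * (1 + x\<^sup>2))"
    unfolding variogram_def
  proof (intro suminf_le summable_variogram summable_mult2 summable_\<sigma>)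
    show "(\<sigma> k)\<^sup>2 * \<bar>x\<bar> powr (2 * H k) \<le> (\<sigma> k)\<^sup>2 * (1 + x\<^sup>2)" for k
      using abs_powr_le_1_plus_square[of "2 * H k" x] Hurst[of k] by (simp add: mult_left_mono)
  qed
  then show ?thesis
    by (simp add: suminf_mult2[OF summable_\<sigma>])
qed

lemma measurable_M [measurable]: "M t \<in> borel_measurable P"
  using mixed by (simp add: multi_mixed_fbm_def)

lemma continuous_M: "\<omega> \<in> space P \<Longrightarrow> continuous_on UNIV (\<lambda>t. M t \<omega>)"
  using mixed by (simp add: multi_mixed_fbm_def continuous_paths_def)

text \<open>The three facts share one family \<open>B\<close> drawn from the existential in
  \<open>multi_mixed_fbm\<close>. Each is computed for the finite partial sums, or follows from
  their square integrability, and is carried over by convergence in mean square.\<close>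

lemma M_moments:
  shows integrable_M_square: "integrable P (\<lambda>\<omega>. (M t \<omega>)\<^sup>2)"
    and expectation_M: "(LINT \<omega>|P. M t \<omega>) = 0"
    and covariance_M: "(LINT \<omega>|P. M s \<omega> * M t \<omega>) =
      1/2 * (variogram \<sigma> H s + variogram \<sigma> H t - variogram \<sigma> H (s - t))"
proof -
  obtain B where fbm: "\<And>k. fractional_brownian_motion P (H k) (B k)"
    and indep: "independent_processes P B"
    and lim: "\<And>t. (\<lambda>n. \<integral>\<^sup>+\<omega>. ennreal ((M t \<omega> - (\<Sum>k<n. \<sigma> k * B k t \<omega>))\<^sup>2) \<partial>P) \<longlonglongrightarrow> 0"
    using mixed by (auto simp: multi_mixed_fbm_def)
  have gB: "gaussian_rv P (B k t)" for k t
    using fbm[of k] unfolding fractional_brownian_motion_def gaussian_process_def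
    by (auto dest!: spec[of _ "{t}"] spec[of _ "\<lambda>_. 1"])
  then have mB [measurable]: "B k t \<in> borel_measurable P" for k t
    by (simp add: gaussian_rv_def)
  have sqB: "integrable P (\<lambda>\<omega>. (B k t \<omega>)\<^sup>2)" for k t
    by (rule gaussian_rv_square_integrable[OF gB])
  have iB: "integrable P (B k t)" for k t
    by (rule square_integrable_imp_integrable[OF mB sqB])
  have iBB: "integrable P (\<lambda>\<omega>. B j s \<omega> * B k t \<omega>)" for j k s t
    by (intro square_integrable_mult sqB mB)
  have EB: "(LINT \<omega>|P. B k t \<omega>) = 0" for k t
    using fbm[of k] by (simp add: fractional_brownian_motion_def)
  have EBB: "(LINT \<omega>|P. B j s \<omega> * B k t \<omega>) =
      (if j = k then 1/2 * (\<bar>s\<bar> powr (2 * H k) + \<bar>t\<bar> powr (2 * H k) - \<bar>s - t\<bar> powr (2 * H k)) else 0)"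
    for j k s t
  proof (cases "j = k")
    case True
    then show ?thesis
      using fbm[of k] by (simp add: fractional_brownian_motion_def)
  next
    case False
    \<comment> \<open>Each path is evaluated at its own time, s for index j and t for index k;
      independence of the paths then passes to these two coordinates.\<close>
    let ?r = "\<lambda>i. if i = j then s else t"
    have "indep_vars (\<lambda>_. PiM UNIV (\<lambda>_. borel)) (\<lambda>i \<omega> t. B i t \<omega>) {j, k}"
      using indep_vars_subset[OF indep[unfolded independent_processes_def]] by simp
    then have "indep_vars (\<lambda>_. borel) (\<lambda>i \<omega>. (\<lambda>p. p (?r i)) (\<lambda>t. B i t \<omega>)) {j, k}"
      by (rule indep_vars_compose2) measurable
    then have "(LINT \<omega>|P. (\<Prod>i\<in>{j, k}. B i (?r i) \<omega>)) = (\<Prod>i\<in>{j, k}. LINT \<omega>|P. B i (?r i) \<omega>)"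
      by (intro indep_vars_lebesgue_integral) (auto simp: iB)
    then show ?thesis
      using False by (simp add: EB)
  qed
  let ?S = "\<lambda>t n \<omega>. \<Sum>k<n. \<sigma> k * B k t \<omega>"
  have prod_S: "?S s n \<omega> * ?S t n \<omega> = (\<Sum>j<n. \<Sum>k<n. \<sigma> j * \<sigma> k * (B j s \<omega> * B k t \<omega>))" for s t n \<omega>
    by (simp add: sum_product mult_ac)
  have iS: "integrable P (\<lambda>\<omega>. ?S s n \<omega> * ?S t n \<omega>)" for s t n
    unfolding prod_S by (intro Bochner_Integration.integrable_sum integrable_mult_right iBB)
  then have sqS: "integrable P (\<lambda>\<omega>. (?S t n \<omega>)\<^sup>2)" for t n
    by (simp add: power2_eq_square)
  have mS: "?S t n \<in> borel_measurable P" for t n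
    by measurable
  have ES: "(LINT \<omega>|P. ?S s n \<omega> * ?S t n \<omega>) =
      (\<Sum>k<n. 1/2 * ((\<sigma> k)\<^sup>2 * \<bar>s\<bar> powr (2 * H k) + (\<sigma> k)\<^sup>2 * \<bar>t\<bar> powr (2 * H k)
         - (\<sigma> k)\<^sup>2 * \<bar>s - t\<bar> powr (2 * H k)))" for s t n
  proof -
    have "(LINT \<omega>|P. ?S s n \<omega> * ?S t n \<omega>) =
        (\<Sum>j<n. \<Sum>k<n. \<sigma> j * \<sigma> k * (LINT \<omega>|P. B j s \<omega> * B k t \<omega>))"
      unfolding prod_S
      by (simp add: Bochner_Integration.integral_sum Bochner_Integration.integrable_sum iBB)
    also have "\<dots> = (\<Sum>j<n. \<Sum>k<n. if j = k then \<sigma> j * \<sigma> k *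
        (1/2 * (\<bar>s\<bar> powr (2 * H k) + \<bar>t\<bar> powr (2 * H k) - \<bar>s - t\<bar> powr (2 * H k))) else 0)"
      unfolding EBB by (intro sum.cong refl) auto
    also have "\<dots> = (\<Sum>j<n. \<sigma> j * \<sigma> j *
        (1/2 * (\<bar>s\<bar> powr (2 * H j) + \<bar>t\<bar> powr (2 * H j) - \<bar>s - t\<bar> powr (2 * H j))))"
      by (intro sum.cong refl) simp
    also have "\<dots> = (\<Sum>k<n. 1/2 * ((\<sigma> k)\<^sup>2 * \<bar>s\<bar> powr (2 * H k) + (\<sigma> k)\<^sup>2 * \<bar>t\<bar> powr (2 * H k)
         - (\<sigma> k)\<^sup>2 * \<bar>s - t\<bar> powr (2 * H k)))"
      by (intro sum.cong refl) (simp add: power2_eq_square algebra_simps)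
    finally show ?thesis .
  qed
  show "integrable P (\<lambda>\<omega>. (M t \<omega>)\<^sup>2)"
    by (rule square_integrable_L2_limit[OF measurable_M mS sqS lim])
  \<comment> \<open>The mean is the inner product with the constant 1, so the same limit theorem
    applies.\<close>
  have "(\<lambda>n. LINT \<omega>|P. ?S t n \<omega> * 1) \<longlonglongrightarrow> (LINT \<omega>|P. M t \<omega> * 1)"
    by (intro L2_limit_integral_mult measurable_M mS sqS lim) auto
  moreover have "(LINT \<omega>|P. ?S t n \<omega> * 1) = 0" for n
    by (simp add: Bochner_Integration.integral_sum iB EB)
  ultimately show "(LINT \<omega>|P. M t \<omega>) = 0"
    by (simp add: LIMSEQ_const_iff)
  have "(\<lambda>n. LINT \<omega>|P. ?S s n \<omega> * ?S t n \<omega>) \<longlonglongrightarrow> (LINT \<omega>|P. M s \<omega> * M t \<omega>)"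
    by (intro L2_limit_integral_mult measurable_M mS sqS lim)
  moreover have "(\<lambda>n. LINT \<omega>|P. ?S s n \<omega> * ?S t n \<omega>) \<longlonglongrightarrow>
      1/2 * (variogram \<sigma> H s + variogram \<sigma> H t - variogram \<sigma> H (s - t))"
    unfolding ES sums_def[symmetric]
    by (intro sums_mult sums_add sums_diff variogram_sums)
  ultimately show "(LINT \<omega>|P. M s \<omega> * M t \<omega>) =
      1/2 * (variogram \<sigma> H s + variogram \<sigma> H t - variogram \<sigma> H (s - t))"
    by (rule LIMSEQ_unique)
qed

lemma integrable_M: "integrable P (M t)"
  by (rule square_integrable_imp_integrable[OF measurable_M integrable_M_square])

lemma integrable_M_mult: "integrable P (\<lambda>\<omega>. M s \<omega> * M t \<omega>)"
  by (intro square_integrable_mult measurable_M integrable_M_square)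

lemma integrable_increment_mult:
  "integrable P (\<lambda>\<omega>. (M s \<omega> - M s' \<omega>) * (M t \<omega> - M t' \<omega>))"
  by (intro square_integrable_mult square_integrable_diff integrable_M_square) measurable

text \<open>The variogram at single times cancels and only time differences remain; this is the
  source of the stationarity of U.\<close>

lemma covariance_increment:
  "(LINT \<omega>|P. (M s \<omega> - M s' \<omega>) * (M t \<omega> - M t' \<omega>)) =
     1/2 * (variogram \<sigma> H (s - t') + variogram \<sigma> H (s' - t) - variogram \<sigma> H (s - t)
       - variogram \<sigma> H (s' - t'))"
proof -
  have "(LINT \<omega>|P. (M s \<omega> - M s' \<omega>) * (M t \<omega> - M t' \<omega>)) =
      (LINT \<omega>|P. M s \<omega> * M t \<omega> - M s' \<omega> * M t \<omega> - (M s \<omega> * M t' \<omega> - M s' \<omega> * M t' \<omega>))"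
    by (simp add: algebra_simps)
  also have "\<dots> = (LINT \<omega>|P. M s \<omega> * M t \<omega>) - (LINT \<omega>|P. M s' \<omega> * M t \<omega>)
      - ((LINT \<omega>|P. M s \<omega> * M t' \<omega>) - (LINT \<omega>|P. M s' \<omega> * M t' \<omega>))"
    by (simp add: integrable_M_mult)
  finally show ?thesis
    unfolding covariance_M by (simp add: algebra_simps)
qed

end

section \<open>Covariance of the Ornstein--Uhlenbeck process\<close>

lemma (in pair_sigma_finite)
  fixes a :: "'a \<Rightarrow> real" and b :: "'b \<Rightarrow> real"
  assumes a: "integrable M1 a" and b: "integrable M2 b"
  shows integrable_fst_mult_snd: "integrable (M1 \<Otimes>\<^sub>M M2) (\<lambda>q. a (fst q) * b (snd q))"
    and integral_fst_mult_snd: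
      "(LINT q|(M1 \<Otimes>\<^sub>M M2). a (fst q) * b (snd q)) = (LINT x|M1. a x) * (LINT y|M2. b y)"
proof -
  have [measurable]: "a \<in> borel_measurable M1" "b \<in> borel_measurable M2"
    using a b by auto
  show int: "integrable (M1 \<Otimes>\<^sub>M M2) (\<lambda>q. a (fst q) * b (snd q))"
    using integrable_abs[OF a] b by (intro Fubini_integrable) (auto simp: abs_mult)
  show "(LINT q|(M1 \<Otimes>\<^sub>M M2). a (fst q) * b (snd q)) = (LINT x|M1. a x) * (LINT y|M2. b y)"
    using integral_fst'[OF int] by simp
qed

text \<open>Time is rounded down to multiples of 1/(n+1). Each rounded process uses countably many
  times and is jointly measurable; path continuity gives the pointwise limit. Fubini arguments rest
  on this.\<close>

lemma measurable_continuous_process: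
  fixes X :: "real \<Rightarrow> 'a \<Rightarrow> real"
  assumes [measurable]: "\<And>t. X t \<in> borel_measurable M"
    and cont: "\<And>\<omega>. \<omega> \<in> space M \<Longrightarrow> continuous_on UNIV (\<lambda>t. X t \<omega>)"
  shows "(\<lambda>p. X (snd p) (fst p)) \<in> borel_measurable (M \<Otimes>\<^sub>M borel)"
proof (rule borel_measurable_LIMSEQ_metric)
  let ?r = "\<lambda>n s. real_of_int \<lfloor>real (Suc n) * s\<rfloor> / real (Suc n)"
  fix n
  show "(\<lambda>p. X (?r n (snd p)) (fst p)) \<in> borel_measurable (M \<Otimes>\<^sub>M borel)"
    by (rule measurable_compose_countable[where f = "\<lambda>i p. X (real_of_int i / real (Suc n)) (fst p)"
          and g = "\<lambda>p. \<lfloor>real (Suc n) * snd p\<rfloor>"]) measurable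
next
  let ?r = "\<lambda>n s. real_of_int \<lfloor>real (Suc n) * s\<rfloor> / real (Suc n)"
  fix p assume p: "p \<in> space (M \<Otimes>\<^sub>M (borel :: real measure))"
  have "(\<lambda>n. ?r n (snd p)) \<longlonglongrightarrow> snd p"
  proof (rule tendsto_sandwich)
    show "\<forall>\<^sub>F n in sequentially. snd p - 1 / real (Suc n) \<le> ?r n (snd p)"
    proof (intro always_eventually allI)
      fix n
      have "real (Suc n) * snd p - 1 \<le> real_of_int \<lfloor>real (Suc n) * snd p\<rfloor>"
        by linarith
      then have "(real (Suc n) * snd p - 1) / real (Suc n) \<le> ?r n (snd p)"
        by (intro divide_right_mono) auto
      then show "snd p - 1 / real (Suc n) \<le> ?r n (snd p)"
        by (simp add: diff_divide_distrib)
    qed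
    show "\<forall>\<^sub>F n in sequentially. ?r n (snd p) \<le> snd p"
    proof (intro always_eventually allI)
      fix n
      have "real_of_int \<lfloor>real (Suc n) * snd p\<rfloor> \<le> real (Suc n) * snd p"
        by linarith
      then have "?r n (snd p) \<le> real (Suc n) * snd p / real (Suc n)"
        by (intro divide_right_mono) auto
      then show "?r n (snd p) \<le> snd p"
        by simp
    qed
    show "(\<lambda>n. snd p - 1 / real (Suc n)) \<longlonglongrightarrow> snd p"
      by real_asymp
  qed auto
  moreover have "isCont (\<lambda>t. X t (fst p)) (snd p)"
    using cont[of "fst p"] p by (auto simp: space_pair_measure continuous_on_eq_continuous_at)
  ultimately show "(\<lambda>n. X (?r n (snd p)) (fst p)) \<longlonglongrightarrow> X (snd p) (fst p)"
    by (rule isCont_tendsto_compose[rotated])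
qed

text \<open>Substitute x = t - s. Both integrals take the value 0 when they diverge, so the identity
  holds for every measurable path. Moving \<open>M t \<omega>\<close> under the integral has to wait
  until integrability is known.\<close>

lemma ornstein_uhlenbeck_eq:
  assumes l: "0 < l" and [measurable]: "(\<lambda>s. M s \<omega>) \<in> borel_measurable borel"
  shows "ornstein_uhlenbeck l M t \<omega> = M t \<omega> - (LINT x|expo l. M (t - x) \<omega>)"
proof -
  have "l * (LINT s:{..t}|lborel. exp (- l * (t - s)) * M s \<omega>) =
      (LINT s|lborel. l * (indicator {..t} s * (exp (- l * (t - s)) * M s \<omega>)))"
    by (simp add: set_lebesgue_integral_def)
  also have "\<dots> = (LINT x|lborel. l * (indicator {..t} (t + - 1 * x) *
      (exp (- l * (t - (t + - 1 * x))) * M (t + - 1 * x) \<omega>)))"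
    by (subst lborel_integral_real_affine[of "- 1" _ t]) auto
  also have "\<dots> = (LINT x|lborel. exponential_density l x *\<^sub>R M (t - x) \<omega>)"
    by (intro Bochner_Integration.integral_cong)
       (auto simp: exponential_density_def mult_ac split: split_indicator)
  also have "\<dots> = (LINT x|expo l. M (t - x) \<omega>)"
    unfolding expo_def using l by (intro integral_density[symmetric]) auto
  finally show ?thesis
    by (simp add: ornstein_uhlenbeck_def)
qed

context mixed_fbm
begin

text \<open>As a raw rule this settles measurability of \<open>M\<close> at times that depend on the
  integration variables.\<close>

lemma measurable_M_pair [measurable (raw)]:
  assumes "f \<in> measurable N P" "h \<in> borel_measurable N"
  shows "(\<lambda>x. M (h x) (f x)) \<in> borel_measurable N"
  using measurable_compose[OF measurable_Pair[OF assms]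
      measurable_continuous_process[OF measurable_M continuous_M]] by simp

text \<open>By Tonelli, integrating over the paths first gives the variogram at the lag, which is at
  most quadratic. The space \<open>R\<close> is kept general to cover both one exponential variable
  and a pair of them.\<close>

lemma integrable_increment_square:
  assumes "prob_space R" and [measurable]: "\<phi> \<in> borel_measurable R"
    and \<phi>: "integrable R (\<lambda>r. (\<phi> r)\<^sup>2)"
  shows "integrable (P \<Otimes>\<^sub>M R) (\<lambda>p. (M t (fst p) - M (t - \<phi> (snd p)) (fst p))\<^sup>2)"
proof (rule integrableI_nonneg)
  interpret R: prob_space R by fact
  interpret PR: pair_prob_space P R ..
  have var: "(\<integral>\<^sup>+\<omega>. ennreal ((M t \<omega> - M (t - x) \<omega>)\<^sup>2) \<partial>P) = ennreal (variogram \<sigma> H x)" for x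
  proof -
    have "(\<integral>\<^sup>+\<omega>. ennreal ((M t \<omega> - M (t - x) \<omega>)\<^sup>2) \<partial>P) =
        ennreal (LINT \<omega>|P. (M t \<omega> - M (t - x) \<omega>)\<^sup>2)"
      using integrable_increment_mult[of t "t - x" t "t - x"]
      by (intro nn_integral_eq_integral) (auto simp: power2_eq_square)
    also have "(LINT \<omega>|P. (M t \<omega> - M (t - x) \<omega>)\<^sup>2) = variogram \<sigma> H x"
      using covariance_increment[of t "t - x" t "t - x"]
      by (simp add: power2_eq_square variogram_minus)
    finally show ?thesis .
  qed
  have "(\<integral>\<^sup>+p. ennreal ((M t (fst p) - M (t - \<phi> (snd p)) (fst p))\<^sup>2) \<partial>(P \<Otimes>\<^sub>M R)) =
      (\<integral>\<^sup>+r. ennreal (variogram \<sigma> H (\<phi> r)) \<partial>R)"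
    by (subst PR.nn_integral_snd[symmetric]) (auto simp: var)
  also have "\<dots> \<le> (\<integral>\<^sup>+r. ennreal ((\<Sum>k. (\<sigma> k)\<^sup>2) * (1 + (\<phi> r)\<^sup>2)) \<partial>R)"
    by (intro nn_integral_mono ennreal_leI variogram_le)
  also have "\<dots> < \<infinity>"
    using \<phi> by (subst nn_integral_eq_integral) (auto intro!: mult_nonneg_nonneg suminf_nonneg summable_\<sigma>)
  finally show "(\<integral>\<^sup>+p. ennreal ((M t (fst p) - M (t - \<phi> (snd p)) (fst p))\<^sup>2) \<partial>(P \<Otimes>\<^sub>M R)) < \<infinity>" .
qed auto

end

section \<open>The stationary process as an exponential average of increments\<close>

locale mixed_fou = mixed_fbm +
  fixes l :: real
  assumes l_pos: "0 < l"
begin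

abbreviation "U \<equiv> ornstein_uhlenbeck l M"

sublocale E: prob_space "expo l"
  by (rule prob_space_expo[OF l_pos])

sublocale Q: pair_prob_space "expo l" "expo l" ..

sublocale PE: pair_prob_space P "expo l" ..

sublocale PQ: pair_prob_space P "expo l \<Otimes>\<^sub>M expo l" ..

lemma U_eq: "\<omega> \<in> space P \<Longrightarrow> U t \<omega> = M t \<omega> - (LINT x|expo l. M (t - x) \<omega>)"
  by (intro ornstein_uhlenbeck_eq l_pos borel_measurable_continuous_onI continuous_M)

lemma measurable_U [measurable]: "U t \<in> borel_measurable P"
proof -
  have "(\<lambda>\<omega>. M t \<omega> - (LINT x|expo l. M (t - x) \<omega>)) \<in> borel_measurable P"
    by measurable
  then show ?thesis
    by (subst measurable_cong[OF U_eq])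
qed

lemma integrable_increment: "integrable (P \<Otimes>\<^sub>M expo l) (\<lambda>p. M t (fst p) - M (t - snd p) (fst p))"
proof (rule PE.square_integrable_imp_integrable)
  show "integrable (P \<Otimes>\<^sub>M expo l) (\<lambda>p. (M t (fst p) - M (t - snd p) (fst p))\<^sup>2)"
    using integrable_increment_square[OF E.prob_space_axioms, of "\<lambda>x. x"]
      integrable_expo_power[OF l_pos, of 2] by simp
qed measurable

text \<open>Fubini gives integrability of the increments along almost every path. As
  \<open>expo l\<close> has mass one, \<open>M t \<omega>\<close> may then enter the
  integral.\<close>

lemma AE_U:
  "AE \<omega> in P. integrable (expo l) (\<lambda>x. M t \<omega> - M (t - x) \<omega>) \<and>
     U t \<omega> = (LINT x|expo l. M t \<omega> - M (t - x) \<omega>)"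
  using PE.AE_integrable_fst'[OF integrable_increment[of t]] AE_space
proof eventually_elim
  case (elim \<omega>)
  then have int: "integrable (expo l) (\<lambda>x. M t \<omega> - M (t - x) \<omega>)"
    by simp
  \<comment> \<open>The path itself is recovered as a constant minus the integrable
    increment.\<close>
  have "integrable (expo l) (\<lambda>x. M t \<omega> - (M t \<omega> - M (t - x) \<omega>))"
    by (rule Bochner_Integration.integrable_diff[OF _ int]) simp
  then have "integrable (expo l) (\<lambda>x. M (t - x) \<omega>)"
    unfolding diff_diff_eq2 add_diff_cancel_left' .
  then show ?case
    using elim int by (simp add: U_eq E.prob_space[unfolded space_expo])
qed

lemma integrable_increment_product:
  "integrable (P \<Otimes>\<^sub>M (expo l \<Otimes>\<^sub>M expo l))
     (\<lambda>p. (M s (fst p) - M (s - fst (snd p)) (fst p)) * (M t (fst p) - M (t - snd (snd p)) (fst p)))"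
proof (intro square_integrable_mult)
  show "integrable (P \<Otimes>\<^sub>M (expo l \<Otimes>\<^sub>M expo l)) (\<lambda>p. (M s (fst p) - M (s - fst (snd p)) (fst p))\<^sup>2)"
    \<comment> \<open>The exponents 2 and 0 select the second moment of the first
      coordinate.\<close>
    using integrable_expo_pair_power[OF l_pos, of 2 0]
    by (intro integrable_increment_square Q.prob_space_axioms) auto
  show "integrable (P \<Otimes>\<^sub>M (expo l \<Otimes>\<^sub>M expo l)) (\<lambda>p. (M t (fst p) - M (t - snd (snd p)) (fst p))\<^sup>2)"
    using integrable_expo_pair_power[OF l_pos, of 0 2]
    by (intro integrable_increment_square Q.prob_space_axioms) auto
qed measurable

text \<open>The two averages are taken over separate coordinates, so their product is a single
  integral over the product law.\<close>

lemma AE_U_mult: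
  "AE \<omega> in P. U s \<omega> * U t \<omega> = (LINT q|(expo l \<Otimes>\<^sub>M expo l).
     (M s \<omega> - M (s - fst q) \<omega>) * (M t \<omega> - M (t - snd q) \<omega>))"
  using AE_U[of s] AE_U[of t]
  by eventually_elim
     (auto intro: Q.integral_fst_mult_snd[of "\<lambda>x. M s _ - M (s - x) _" "\<lambda>x. M t _ - M (t - x) _", symmetric])

lemma integrable_U_mult: "integrable P (\<lambda>\<omega>. U s \<omega> * U t \<omega>)"
proof (subst integrable_cong_AE[OF _ _ AE_U_mult])
  show "integrable P (\<lambda>\<omega>. LINT q|(expo l \<Otimes>\<^sub>M expo l).
     (M s \<omega> - M (s - fst q) \<omega>) * (M t \<omega> - M (t - snd q) \<omega>))"
    using PQ.integrable_fst'[OF integrable_increment_product[of s t]] by simp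
qed measurable

lemma expectation_U: "(LINT \<omega>|P. U t \<omega>) = 0"
proof -
  have "(LINT \<omega>|P. U t \<omega>) = (LINT \<omega>|P. LINT x|expo l. M t \<omega> - M (t - x) \<omega>)"
    using AE_U[of t] by (intro integral_cong_AE) auto
  also have "\<dots> = (LINT x|expo l. LINT \<omega>|P. M t \<omega> - M (t - x) \<omega>)"
    using integrable_increment[of t] by (intro PE.Fubini_integral[symmetric]) (simp add: case_prod_unfold)
  also have "\<dots> = 0"
    by (simp add: integrable_M expectation_M)
  finally show ?thesis .
qed

text \<open>The times enter through t - s only, which yields covariance stationarity.\<close>

lemma covariance_U:
  "(LINT \<omega>|P. U s \<omega> * U t \<omega>) =
     1/2 * exp_second_difference l (\<lambda>z. variogram \<sigma> H (t - s + z))"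
proof -
  have "(LINT \<omega>|P. U s \<omega> * U t \<omega>) = (LINT \<omega>|P. LINT q|(expo l \<Otimes>\<^sub>M expo l).
     (M s \<omega> - M (s - fst q) \<omega>) * (M t \<omega> - M (t - snd q) \<omega>))"
    by (intro integral_cong_AE AE_U_mult) measurable
  also have "\<dots> = (LINT q|(expo l \<Otimes>\<^sub>M expo l). LINT \<omega>|P.
     (M s \<omega> - M (s - fst q) \<omega>) * (M t \<omega> - M (t - snd q) \<omega>))"
    using integrable_increment_product[of s t]
    by (intro PQ.Fubini_integral[symmetric]) (simp add: case_prod_unfold)
  also have "\<dots> = (LINT q|(expo l \<Otimes>\<^sub>M expo l). 1/2 *
      (variogram \<sigma> H (t - s + fst q) + variogram \<sigma> H (t - s + - snd q)
        - variogram \<sigma> H (t - s + 0) - variogram \<sigma> H (t - s + (fst q - snd q))))"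
  proof (intro Bochner_Integration.integral_cong refl)
    fix q :: "real \<times> real"
    show "(LINT \<omega>|P. (M s \<omega> - M (s - fst q) \<omega>) * (M t \<omega> - M (t - snd q) \<omega>)) = 1/2 *
      (variogram \<sigma> H (t - s + fst q) + variogram \<sigma> H (t - s + - snd q)
        - variogram \<sigma> H (t - s + 0) - variogram \<sigma> H (t - s + (fst q - snd q)))"
      \<comment> \<open>Evenness of the variogram reverses the sign of all four lags.\<close>
      using variogram_minus[of \<sigma> H "t - s + fst q"] variogram_minus[of \<sigma> H "t - s - snd q"]
        variogram_minus[of \<sigma> H "t - s"] variogram_minus[of \<sigma> H "t - s + fst q - snd q"]
      unfolding covariance_increment by (simp add: algebra_simps)
  qed
  also have "\<dots> = 1/2 * exp_second_difference l (\<lambda>z. variogram \<sigma> H (t - s + z))"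
    by (simp add: exp_second_difference_def)
  finally show ?thesis .
qed

lemma covariance_stationary_U: "covariance_stationary P U"
  unfolding covariance_stationary_def
  using integrable_U_mult by (auto simp: expectation_U covariance_U power2_eq_square)

lemma autocovariance_U:
  "autocovariance P U t = 1/2 * exp_second_difference l (\<lambda>z. variogram \<sigma> H (t + z))"
  by (simp add: autocovariance_def expectation_U covariance_U)

end

section \<open>Asymptotics of the autocovariance\<close>

lemma nn_integral_powr_atLeast:
  fixes p t0 :: real
  assumes p: "p < - 1" and t0: "0 < t0"
  shows "(\<integral>\<^sup>+t\<in>{t0..}. ennreal (t powr p) \<partial>lborel) = ennreal (t0 powr (p + 1) / - (p + 1))"
proof -
  have "(\<integral>\<^sup>+t\<in>{t0..}. ennreal (t powr p) \<partial>lborel) = ennreal (0 - t0 powr (p + 1) / (p + 1))"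
  proof (rule nn_integral_FTC_atLeast)
    fix t assume t: "t0 \<le> t"
    with t0 have "((\<lambda>t. t powr (p + 1)) has_real_derivative (p + 1) * t powr (p + 1 - 1)) (at t)"
      by (intro has_real_derivative_powr) auto
    from DERIV_cdivide[OF this, of "p + 1"]
    show "((\<lambda>t. t powr (p + 1) / (p + 1)) has_real_derivative t powr p) (at t)"
      using p by simp
  next
    have "((\<lambda>t. t powr (p + 1)) \<longlongrightarrow> 0) at_top"
      using p by (intro tendsto_neg_powr filterlim_ident) auto
    from tendsto_divide_zero[OF this] show "((\<lambda>t. t powr (p + 1) / (p + 1)) \<longlongrightarrow> 0) at_top" .
  qed auto
  then show ?thesis
    by (simp only: diff_0 minus_divide_right)
qed

lemma nn_integral_inverse_atLeast:
  fixes t0 :: real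
  assumes t0: "0 < t0"
  shows "(\<integral>\<^sup>+t\<in>{t0..}. ennreal (1 / t) \<partial>lborel) = \<infinity>"
proof (rule ccontr)
  let ?I = "\<integral>\<^sup>+t\<in>{t0..}. ennreal (1 / t) \<partial>lborel"
  assume "?I \<noteq> \<infinity>"
  then obtain r where r: "?I = ennreal r" "0 \<le> r"
    by (cases ?I) auto
  obtain n where n: "r < real n"
    using reals_Archimedean2 by blast
  \<comment> \<open>Over the interval from t0 to \<open>t0 * exp n\<close> the integral is exactly
    n, so no finite r can bound it.\<close>
  have "ennreal (real n) = ennreal (ln (t0 * exp (real n)) - ln t0)"
    using t0 by (simp add: ln_mult)
  also have "\<dots> = (\<integral>\<^sup>+t. ennreal (1 / t) * indicator {t0..t0 * exp (real n)} t \<partial>lborel)"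
    using t0 by (intro nn_integral_FTC_Icc[symmetric]) (auto intro!: derivative_eq_intros)
  also have "\<dots> \<le> ?I"
    by (intro nn_integral_mono) (auto split: split_indicator)
  finally show False
    using r n by simp
qed

section \<open>Expansion of the variogram and of the autocovariance\<close>

context mixed_fou
begin

lemma summable_powr_sequence:
  assumes "0 < t"
  shows "summable (\<lambda>k. (\<sigma> k)\<^sup>2 * t powr (2 * H k - real j))"
  using summable_divide[OF summable_variogram[of t], of "t ^ j"] by (simp add: powr_diff_nat assms)

lemma suminf_powr_sequence_le:
  assumes "0 < t"
  shows "(\<Sum>k. (\<sigma> k)\<^sup>2 * t powr (2 * H k - real j)) \<le> (\<Sum>k. (\<sigma> k)\<^sup>2) * (1 + t\<^sup>2) / t ^ j"
proof -
  have "(\<Sum>k. (\<sigma> k)\<^sup>2 * t powr (2 * H k - real j)) = variogram \<sigma> H t / t ^ j"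
    unfolding variogram_def using suminf_divide[OF summable_variogram[of t], of "t ^ j"]
    by (simp add: powr_diff_nat assms)
  also have "\<dots> \<le> (\<Sum>k. (\<sigma> k)\<^sup>2) * (1 + t\<^sup>2) / t ^ j"
    using assms by (intro divide_right_mono variogram_le) auto
  finally show ?thesis .
qed

lemma summable_binomial_powr:
  assumes "0 < t"
  shows "summable (\<lambda>k. (\<sigma> k)\<^sup>2 * ((2 * H k gchoose j) * t powr (2 * H k - real j)))"
proof (rule summable_comparison_test')
  show "summable (\<lambda>k. (real j + 1) * ((\<sigma> k)\<^sup>2 * t powr (2 * H k - real j)))"
    by (intro summable_mult summable_powr_sequence assms)
  show "norm ((\<sigma> k)\<^sup>2 * ((2 * H k gchoose j) * t powr (2 * H k - real j)))
      \<le> (real j + 1) * ((\<sigma> k)\<^sup>2 * t powr (2 * H k - real j))" for k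
    using mult_right_mono[OF abs_gbinomial_le[of "2 * H k" j], of "(\<sigma> k)\<^sup>2 * t powr (2 * H k - real j)"]
      Hurst[of k] by (simp add: abs_mult mult_ac)
qed

text \<open>For positive t this is the j-th Taylor coefficient of the variogram at t, formed term by
  term.\<close>

definition variogram_coeff :: "nat \<Rightarrow> real \<Rightarrow> real" where
  "variogram_coeff j t = (\<Sum>k. (\<sigma> k)\<^sup>2 * ((2 * H k gchoose j) * t powr (2 * H k - real j)))"

text \<open>The remainder bound for one power has a constant independent of the exponent, so it can
  be summed over the components.\<close>

lemma variogram_expansion:
  assumes "2 \<le> m"
  obtains C :: real where "0 \<le> C"
    "\<And>t z. 0 < t \<Longrightarrow> \<bar>variogram \<sigma> H (t + z) - (\<Sum>j<m. variogram_coeff j t * z ^ j)\<bar>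
       \<le> C * (\<Sum>k. (\<sigma> k)\<^sup>2 * t powr (2 * H k - real m)) * \<bar>z\<bar> ^ m"
proof -
  obtain C :: real where C: "0 \<le> C"
    "\<And>a t z. 0 \<le> a \<Longrightarrow> a \<le> 2 \<Longrightarrow> 0 < t \<Longrightarrow>
       \<bar>\<bar>t + z\<bar> powr a - (\<Sum>j<m. (a gchoose j) * t powr (a - real j) * z ^ j)\<bar>
         \<le> C * t powr (a - real m) * \<bar>z\<bar> ^ m"
    by (rule abs_powr_remainder[OF assms]) blast
  show thesis
  proof (rule that[OF C(1)])
    fix t z :: real
    assume t: "0 < t"
    let ?d = "\<lambda>k. (\<sigma> k)\<^sup>2 * (\<bar>t + z\<bar> powr (2 * H k)
        - (\<Sum>j<m. (2 * H k gchoose j) * t powr (2 * H k - real j) * z ^ j))"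
    have "(\<lambda>k. \<Sum>j<m. (\<sigma> k)\<^sup>2 * ((2 * H k gchoose j) * t powr (2 * H k - real j)) * z ^ j) sums
        (\<Sum>j<m. variogram_coeff j t * z ^ j)"
      unfolding variogram_coeff_def
      by (intro sums_sum sums_mult2 summable_sums summable_binomial_powr t)
    from sums_diff[OF variogram_sums this]
    have "?d sums (variogram \<sigma> H (t + z) - (\<Sum>j<m. variogram_coeff j t * z ^ j))"
      by (simp add: right_diff_distrib sum_distrib_left mult.assoc)
    then have eq: "variogram \<sigma> H (t + z) - (\<Sum>j<m. variogram_coeff j t * z ^ j) = suminf ?d"
      by (rule sums_unique)
    have "norm (suminf ?d) \<le> (\<Sum>k. (\<sigma> k)\<^sup>2 * t powr (2 * H k - real m) * (C * \<bar>z\<bar> ^ m))"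
    proof (rule norm_suminf_le)
      fix k
      have "\<bar>?d k\<bar> \<le> (\<sigma> k)\<^sup>2 * (C * t powr (2 * H k - real m) * \<bar>z\<bar> ^ m)"
        unfolding abs_mult abs_power2 using Hurst[of k] by (intro mult_left_mono C(2) t) auto
      then show "norm (?d k) \<le> (\<sigma> k)\<^sup>2 * t powr (2 * H k - real m) * (C * \<bar>z\<bar> ^ m)"
        by (simp add: mult_ac)
    qed (intro summable_mult2 summable_powr_sequence t)
    also have "\<dots> = (\<Sum>k. (\<sigma> k)\<^sup>2 * t powr (2 * H k - real m)) * (C * \<bar>z\<bar> ^ m)"
      by (rule suminf_mult2[symmetric, OF summable_powr_sequence[OF t]])
    finally show "\<bar>variogram \<sigma> H (t + z) - (\<Sum>j<m. variogram_coeff j t * z ^ j)\<bar>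
       \<le> C * (\<Sum>k. (\<sigma> k)\<^sup>2 * t powr (2 * H k - real m)) * \<bar>z\<bar> ^ m"
      unfolding eq by (simp add: mult_ac)
  qed
qed

lemma gbinomial_term_eq:
  assumes n: "1 \<le> n" and t: "0 < t"
  shows "(\<sigma> k)\<^sup>2 * l powr (- 2 * real n) * (\<Prod>j=0..2*n-1. 2 * H k - real j) * t powr (2 * H k - 2 * real n)
    = (\<sigma> k)\<^sup>2 * ((2 * H k gchoose (2*n)) * t powr (2 * H k - real (2*n))) * (fact (2*n) / l ^ (2*n))"
proof -
  \<comment> \<open>This uses that n is positive: for n = 0 truncated subtraction would leave the
    set {0} instead of the empty one.\<close>
  have "{0..2*n-1} = {0..<2*n}"
    using n by auto
  then have "(\<Prod>j=0..2*n-1. 2 * H k - real j) = (2 * H k gchoose (2*n)) * fact (2*n)"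
    by (simp add: gbinomial_mult_fact')
  moreover have "l powr (- 2 * real n) = 1 / l ^ (2*n)"
    using l_pos by (simp add: powr_minus_divide powr_realpow[symmetric])
  ultimately show ?thesis
    by simp
qed

text \<open>Kept in the literal form of the theorem, so that unfolding it produces the claimed
  expansion.\<close>

definition autocovariance_expansion :: "nat \<Rightarrow> real \<Rightarrow> real" where
  "autocovariance_expansion N t = 1/2 * (\<Sum>k. \<Sum>n=1..N. (\<sigma> k)\<^sup>2 * l powr (- 2 * real n) *
     (\<Prod>j=0..2*n-1. 2 * H k - real j) * t powr (2 * H k - 2 * real n))"

lemma autocovariance_expansion_eq:
  assumes t: "0 < t"
  shows "autocovariance_expansion N t = 1/2 * (\<Sum>n=1..N. variogram_coeff (2*n) t * (fact (2*n) / l ^ (2*n)))"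
proof -
  have "(\<Sum>k. \<Sum>n=1..N. (\<sigma> k)\<^sup>2 * l powr (- 2 * real n) *
      (\<Prod>j=0..2*n-1. 2 * H k - real j) * t powr (2 * H k - 2 * real n)) =
    (\<Sum>k. \<Sum>n=1..N. (\<sigma> k)\<^sup>2 * ((2 * H k gchoose (2*n)) * t powr (2 * H k - real (2*n)))
      * (fact (2*n) / l ^ (2*n)))"
    by (intro suminf_cong sum.cong refl gbinomial_term_eq t) auto
  also have "\<dots> = (\<Sum>n=1..N. \<Sum>k. (\<sigma> k)\<^sup>2 * ((2 * H k gchoose (2*n)) * t powr (2 * H k - real (2*n)))
      * (fact (2*n) / l ^ (2*n)))"
    by (intro suminf_sum summable_mult2 summable_binomial_powr t)
  also have "\<dots> = (\<Sum>n=1..N. variogram_coeff (2*n) t * (fact (2*n) / l ^ (2*n)))"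
    unfolding variogram_coeff_def
    by (intro sum.cong refl suminf_mult2[symmetric] summable_binomial_powr t)
  finally show ?thesis
    by (simp only: autocovariance_expansion_def)
qed

text \<open>The bound keeps the series in t: estimating it through the supremum of \<open>H\<close>
  gives the error term, while estimating it through \<open>variogram_le\<close> gives the integrable
  error used in the dichotomy.\<close>

lemma autocovariance_remainder:
  obtains K :: real where "0 \<le> K"
    "\<And>t. 0 < t \<Longrightarrow> \<bar>autocovariance P U t - autocovariance_expansion N t\<bar>
       \<le> K * (\<Sum>k. (\<sigma> k)\<^sup>2 * t powr (2 * H k - real (2*N+2)))"
proof -
  obtain C :: real where C: "0 \<le> C"
    "\<And>t z. 0 < t \<Longrightarrow> \<bar>variogram \<sigma> H (t + z) - (\<Sum>j<2*N+2. variogram_coeff j t * z ^ j)\<bar>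
       \<le> C * (\<Sum>k. (\<sigma> k)\<^sup>2 * t powr (2 * H k - real (2*N+2))) * \<bar>z\<bar> ^ (2*N+2)"
    by (rule variogram_expansion[of "2*N+2"]) (simp, blast)
  obtain D :: real where D: "0 \<le> D"
    "\<And>f c K. f \<in> borel_measurable borel \<Longrightarrow>
      (\<And>z. \<bar>f z - (\<Sum>j<2*N+2. c j * z ^ j)\<bar> \<le> K * \<bar>z\<bar> ^ (2*N+2)) \<Longrightarrow>
      \<bar>exp_second_difference l f - (\<Sum>n=1..N. c (2*n) * (fact (2*n) / l ^ (2*n)))\<bar> \<le> K * D"
    by (rule second_difference_expansion[OF l_pos, of N]) blast
  show thesis
  proof (rule that)
    show "0 \<le> C * D / 2"
      using C(1) D(1) by simp
    fix t :: real
    assume t: "0 < t"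
    let ?e = "\<Sum>k. (\<sigma> k)\<^sup>2 * t powr (2 * H k - real (2*N+2))"
    let ?E = "exp_second_difference l (\<lambda>z. variogram \<sigma> H (t + z))"
    let ?S = "\<Sum>n=1..N. variogram_coeff (2*n) t * (fact (2*n) / l ^ (2*n))"
    have half: "\<bar>x / 2\<bar> \<le> a * b / 2 * c" if "\<bar>x\<bar> \<le> a * c * b" for x a b c :: real
      using that by (simp add: mult_ac)
    have "\<bar>?E - ?S\<bar> \<le> C * ?e * D"
      by (rule D(2)) (measurable, rule C(2)[OF t])
    then have "\<bar>(?E - ?S) / 2\<bar> \<le> C * D / 2 * ?e"
      by (rule half)
    moreover have "autocovariance P U t - autocovariance_expansion N t = (?E - ?S) / 2"
      by (simp add: autocovariance_U autocovariance_expansion_eq[OF t] diff_divide_distrib)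
    ultimately show "\<bar>autocovariance P U t - autocovariance_expansion N t\<bar> \<le> C * D / 2 * ?e"
      by (simp only:)
  qed
qed

lemma autocovariance_bigo:
  "(\<lambda>t. autocovariance P U t - autocovariance_expansion N t)
     \<in> O[at_top](\<lambda>t. t powr (2 * (SUP k. H k) - 2 * real N - 2))"
proof -
  let ?h = "SUP k. H k"
  obtain K where K: "0 \<le> K"
    "\<And>t. 0 < t \<Longrightarrow> \<bar>autocovariance P U t - autocovariance_expansion N t\<bar>
       \<le> K * (\<Sum>k. (\<sigma> k)\<^sup>2 * t powr (2 * H k - real (2*N+2)))"
    by (rule autocovariance_remainder[of N]) blast
  have bdd: "bdd_above (range H)"
    using Hurst by (intro bdd_aboveI[of _ 1]) (auto intro: less_imp_le)
  show ?thesis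
  proof (rule bigoI)
    show "\<forall>\<^sub>F t in at_top. norm (autocovariance P U t - autocovariance_expansion N t)
        \<le> K * (\<Sum>k. (\<sigma> k)\<^sup>2) * norm (t powr (2 * ?h - 2 * real N - 2))"
      \<comment> \<open>For t at least 1 the power increases with its exponent, so each
        \<open>H k\<close> may be replaced by the supremum.\<close>
      using eventually_ge_at_top[of 1]
    proof eventually_elim
      case (elim t)
      have "(\<Sum>k. (\<sigma> k)\<^sup>2 * t powr (2 * H k - real (2*N+2)))
          \<le> (\<Sum>k. (\<sigma> k)\<^sup>2 * t powr (2 * ?h - real (2*N+2)))"
      proof (intro suminf_le summable_powr_sequence summable_mult2 summable_\<sigma> mult_left_mono powr_mono)
        show "2 * H k - real (2*N+2) \<le> 2 * ?h - real (2*N+2)" for k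
          using cSUP_upper[OF _ bdd, of k] by simp
      qed (use elim in auto)
      also have "\<dots> = (\<Sum>k. (\<sigma> k)\<^sup>2) * t powr (2 * ?h - real (2*N+2))"
        by (rule suminf_mult2[symmetric, OF summable_\<sigma>])
      also have "2 * ?h - real (2*N+2) = 2 * ?h - 2 * real N - 2"
        by simp
      finally have "K * (\<Sum>k. (\<sigma> k)\<^sup>2 * t powr (2 * H k - real (2*N+2)))
          \<le> K * ((\<Sum>k. (\<sigma> k)\<^sup>2) * t powr (2 * ?h - 2 * real N - 2))"
        by (rule mult_left_mono[OF _ K(1)])
      then show ?case
        using K(2)[of t] elim by (simp add: mult.assoc)
    qed
  qed
qed

section \<open>Leading term and range of dependence\<close>

definition leading_coeff :: "nat \<Rightarrow> real" where
  "leading_coeff k = (\<sigma> k)\<^sup>2 * H k * (2 * H k - 1) / l\<^sup>2"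

lemma abs_leading_coeff_le: "\<bar>leading_coeff k\<bar> \<le> (\<sigma> k)\<^sup>2 / l\<^sup>2"
proof -
  have "H k * \<bar>2 * H k - 1\<bar> \<le> 1 * 1"
    using Hurst[of k] by (intro mult_mono) auto
  then have "(\<sigma> k)\<^sup>2 * (H k * \<bar>2 * H k - 1\<bar>) \<le> (\<sigma> k)\<^sup>2 * 1"
    by (intro mult_left_mono) auto
  then show ?thesis
    using Hurst[of k] by (simp add: leading_coeff_def abs_mult mult.assoc divide_right_mono)
qed

lemma summable_leading:
  assumes "0 < t"
  shows "summable (\<lambda>k. \<bar>leading_coeff k\<bar> * t powr (2 * H k - 2))"
proof (rule summable_comparison_test')
  show "summable (\<lambda>k. (\<sigma> k)\<^sup>2 * t powr (2 * H k - 2) / l\<^sup>2)"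
    using summable_powr_sequence[OF assms, of 2] by (intro summable_divide) simp
  show "norm (\<bar>leading_coeff k\<bar> * t powr (2 * H k - 2)) \<le> (\<sigma> k)\<^sup>2 * t powr (2 * H k - 2) / l\<^sup>2" for k
    using mult_right_mono[OF abs_leading_coeff_le[of k], of "t powr (2 * H k - 2)"] by simp
qed

text \<open>This is the case N = 1. The quadratic bound on the variogram divided by the fourth power
  of t leaves an error integrable at infinity, whatever the supremum of \<open>H\<close> is.\<close>

lemma autocovariance_leading_term:
  obtains K :: real where "0 \<le> K"
    "\<And>t. 0 < t \<Longrightarrow> \<bar>autocovariance P U t - (\<Sum>k. leading_coeff k * t powr (2 * H k - 2))\<bar>
       \<le> K * (t powr (- 4) + t powr (- 2))"
proof -
  obtain K where K: "0 \<le> K"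
    "\<And>t. 0 < t \<Longrightarrow> \<bar>autocovariance P U t - autocovariance_expansion 1 t\<bar>
       \<le> K * (\<Sum>k. (\<sigma> k)\<^sup>2 * t powr (2 * H k - real (2*1+2)))"
    by (rule autocovariance_remainder[of 1]) blast
  let ?S = "\<Sum>k. (\<sigma> k)\<^sup>2"
  show thesis
  proof (rule that)
    show "0 \<le> K * ?S"
      using K(1) by (intro mult_nonneg_nonneg suminf_nonneg summable_\<sigma>) auto
    fix t :: real
    assume t: "0 < t"
    have "{0..1::nat} = {0, 1}" by auto
    \<comment> \<open>The factor 1/2 in front of the expansion cancels the 2 in
      \<open>2 * H k\<close>.\<close>
    then have summand: "1/2 * ((\<sigma> k)\<^sup>2 * l powr (- 2) * (\<Prod>j=0..1. 2 * H k - real j) * t powr (2 * H k - 2)) =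
        leading_coeff k * t powr (2 * H k - 2)" for k
      using l_pos by (simp add: leading_coeff_def powr_minus_divide powr_numeral)
    have "summable (\<lambda>k. leading_coeff k * t powr (2 * H k - 2))"
      by (rule summable_norm_cancel) (use summable_leading[OF t] in \<open>simp add: abs_mult\<close>)
    then have "summable (\<lambda>k. 2 * (leading_coeff k * t powr (2 * H k - 2)))"
      by (rule summable_mult)
    moreover have "2 * (leading_coeff k * t powr (2 * H k - 2)) =
        (\<sigma> k)\<^sup>2 * l powr (- 2) * (\<Prod>j=0..1. 2 * H k - real j) * t powr (2 * H k - 2)" for k
      unfolding summand[symmetric] by simp
    ultimately have "summable (\<lambda>k. (\<sigma> k)\<^sup>2 * l powr (- 2) * (\<Prod>j=0..1. 2 * H k - real j) * t powr (2 * H k - 2))"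
      by (simp only:)
    from suminf_mult[OF this, of "1/2"]
    have eq: "autocovariance_expansion 1 t = (\<Sum>k. leading_coeff k * t powr (2 * H k - 2))"
      unfolding summand by (simp add: autocovariance_expansion_def)
    have "(\<Sum>k. (\<sigma> k)\<^sup>2 * t powr (2 * H k - real (2*1+2))) \<le> ?S * (1 + t\<^sup>2) / t ^ 4"
      using suminf_powr_sequence_le[OF t, of 4] by simp
    also have "\<dots> = ?S * (t powr (- 4) + t powr (- 2))"
      using t by (simp add: powr_minus_divide powr_numeral field_simps eval_nat_numeral)
    finally have "K * (\<Sum>k. (\<sigma> k)\<^sup>2 * t powr (2 * H k - real (2*1+2))) \<le> K * (?S * (t powr (- 4) + t powr (- 2)))"
      by (rule mult_left_mono[OF _ K(1)])
    then show "\<bar>autocovariance P U t - (\<Sum>k. leading_coeff k * t powr (2 * H k - 2))\<bar>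
       \<le> K * ?S * (t powr (- 4) + t powr (- 2))"
      using K(2)[OF t] unfolding eq by (simp only: mult.assoc)
  qed
qed

text \<open>The denominator 1 - 2 \<open>H k\<close> of the integral cancels against the
  coefficient, leaving a bound that is summable in k even when \<open>H k\<close> accumulates at
  1/2. At exactly 1/2 the power is not integrable, but its coefficient is 0.\<close>

lemma nn_integral_leading_term:
  assumes "H k \<le> 1/2" and t0: "0 < t0"
  shows "(\<integral>\<^sup>+t\<in>{t0..}. ennreal (\<bar>leading_coeff k\<bar> * t powr (2 * H k - 2)) \<partial>lborel)
           \<le> ennreal ((\<sigma> k)\<^sup>2 * t0 powr (2 * H k - 1) / l\<^sup>2)"
proof (cases "H k = 1/2")
  case True
  then have "leading_coeff k = 0"
    by (simp add: leading_coeff_def)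
  then show ?thesis by simp
next
  case False
  then have lt: "2 * H k - 2 < - 1"
    using assms by simp
  have "(\<integral>\<^sup>+t\<in>{t0..}. ennreal (\<bar>leading_coeff k\<bar> * t powr (2 * H k - 2)) \<partial>lborel) =
      ennreal \<bar>leading_coeff k\<bar> * (\<integral>\<^sup>+t\<in>{t0..}. ennreal (t powr (2 * H k - 2)) \<partial>lborel)"
    by (subst nn_integral_cmult[symmetric]) (auto simp: ennreal_mult mult.assoc)
  also have "\<dots> = ennreal \<bar>leading_coeff k\<bar> * ennreal (t0 powr (2 * H k - 1) / (1 - 2 * H k))"
    using nn_integral_powr_atLeast[OF lt t0] by simp
  also have "\<dots> = ennreal (\<bar>leading_coeff k\<bar> * (t0 powr (2 * H k - 1) / (1 - 2 * H k)))"
    using lt by (intro ennreal_mult[symmetric]) auto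
  also have "\<bar>leading_coeff k\<bar> * (t0 powr (2 * H k - 1) / (1 - 2 * H k)) =
      (\<sigma> k)\<^sup>2 * t0 powr (2 * H k - 1) / l\<^sup>2 * H k"
  proof -
    have "\<bar>2 * H k - 1\<bar> = 1 - 2 * H k"
      using lt by simp
    then have "\<bar>leading_coeff k\<bar> = (\<sigma> k)\<^sup>2 * H k * (1 - 2 * H k) / l\<^sup>2"
      using Hurst[of k] by (simp add: leading_coeff_def abs_mult)
    then show ?thesis
      using lt by simp
  qed
  also have "\<dots> \<le> (\<sigma> k)\<^sup>2 * t0 powr (2 * H k - 1) / l\<^sup>2"
    using Hurst[of k] by (intro mult_left_le) auto
  finally show ?thesis
    by (simp add: ennreal_leI)
qed

text \<open>Absolute values are taken term by term, so the series is integrated termwise without a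
  convergence condition; the bounds for the single components are then summed.\<close>

lemma short_range_if_all_le_half:
  assumes le: "\<And>k. H k \<le> 1/2" and t0: "0 < t0"
  shows "(\<integral>\<^sup>+t\<in>{t0..}. ennreal \<bar>autocovariance P U t\<bar> \<partial>lborel) < \<infinity>"
proof -
  obtain K where K: "0 \<le> K"
    "\<And>t. 0 < t \<Longrightarrow> \<bar>autocovariance P U t - (\<Sum>k. leading_coeff k * t powr (2 * H k - 2))\<bar>
       \<le> K * (t powr (- 4) + t powr (- 2))"
    by (rule autocovariance_leading_term) blast
  let ?c = "\<lambda>k t. ennreal (\<bar>leading_coeff k\<bar> * t powr (2 * H k - 2))"
  let ?r = "\<lambda>t. ennreal K * (ennreal (t powr (- 4)) + ennreal (t powr (- 2)))"
  have pointwise: "ennreal \<bar>autocovariance P U t\<bar> \<le> (\<Sum>k. ?c k t) + ?r t" if t: "0 < t" for t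
  proof -
    let ?A = "\<Sum>k. leading_coeff k * t powr (2 * H k - 2)"
    have "\<bar>?A\<bar> \<le> (\<Sum>k. \<bar>leading_coeff k * t powr (2 * H k - 2)\<bar>)"
      by (rule summable_rabs) (use summable_leading[OF t] in \<open>simp add: abs_mult\<close>)
    also have "\<dots> = (\<Sum>k. \<bar>leading_coeff k\<bar> * t powr (2 * H k - 2))"
      by (simp add: abs_mult)
    finally have "\<bar>autocovariance P U t\<bar> \<le>
        (\<Sum>k. \<bar>leading_coeff k\<bar> * t powr (2 * H k - 2)) + K * (t powr (- 4) + t powr (- 2))"
      using K(2)[OF t] by linarith
    then have "ennreal \<bar>autocovariance P U t\<bar> \<le>
        ennreal ((\<Sum>k. \<bar>leading_coeff k\<bar> * t powr (2 * H k - 2)) + K * (t powr (- 4) + t powr (- 2)))"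
      by (rule ennreal_leI)
    also have "\<dots> = (\<Sum>k. ?c k t) + ?r t"
      using K(1) suminf_ennreal2[OF _ summable_leading[OF t]] summable_leading[OF t]
      by (subst ennreal_plus) (auto intro!: suminf_nonneg simp: ennreal_mult)
    finally show ?thesis .
  qed
  have "(\<integral>\<^sup>+t\<in>{t0..}. ennreal \<bar>autocovariance P U t\<bar> \<partial>lborel) \<le>
      (\<integral>\<^sup>+t. (\<Sum>k. ?c k t * indicator {t0..} t) + ennreal K * (ennreal (t powr (- 4)) * indicator {t0..} t
        + ennreal (t powr (- 2)) * indicator {t0..} t) \<partial>lborel)"
  proof (rule nn_integral_mono)
    fix t
    show "ennreal \<bar>autocovariance P U t\<bar> * indicator {t0..} t \<le>
        (\<Sum>k. ?c k t * indicator {t0..} t) + ennreal K * (ennreal (t powr (- 4)) * indicator {t0..} t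
          + ennreal (t powr (- 2)) * indicator {t0..} t)"
    proof (cases "t0 \<le> t")
      case True
      then have "indicator {t0..} t = (1 :: ennreal)"
        by simp
      then show ?thesis
        using pointwise[of t] True t0 by (simp only: mult_1_right)
    qed simp
  qed
  also have "\<dots> = (\<Sum>k. \<integral>\<^sup>+t\<in>{t0..}. ?c k t \<partial>lborel) +
      ennreal K * ((\<integral>\<^sup>+t\<in>{t0..}. ennreal (t powr (- 4)) \<partial>lborel)
        + (\<integral>\<^sup>+t\<in>{t0..}. ennreal (t powr (- 2)) \<partial>lborel))"
    by (subst nn_integral_add, measurable, subst nn_integral_suminf, measurable,
        subst nn_integral_cmult, measurable, subst nn_integral_add, measurable)
  also have "\<dots> < \<infinity>"
  proof -
    have "(\<Sum>k. \<integral>\<^sup>+t\<in>{t0..}. ?c k t \<partial>lborel) \<le> (\<Sum>k. ennreal ((\<sigma> k)\<^sup>2 * t0 powr (2 * H k - 1) / l\<^sup>2))"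
      by (intro suminf_le nn_integral_leading_term le t0) auto
    also have "\<dots> = ennreal (\<Sum>k. (\<sigma> k)\<^sup>2 * t0 powr (2 * H k - 1) / l\<^sup>2)"
      \<comment> \<open>The bounds form the series of the variogram at t0 divided by t0, up to the
        factor \<open>1 / l\<^sup>2\<close>.\<close>
      using summable_powr_sequence[OF t0, of 1] by (intro suminf_ennreal2 summable_divide) auto
    also have "\<dots> < \<infinity>"
      by simp
    finally have "(\<Sum>k. \<integral>\<^sup>+t\<in>{t0..}. ?c k t \<partial>lborel) < \<infinity>" .
    moreover have "(\<integral>\<^sup>+t\<in>{t0..}. ennreal (t powr (- 4)) \<partial>lborel) < \<infinity>"
      "(\<integral>\<^sup>+t\<in>{t0..}. ennreal (t powr (- 2)) \<partial>lborel) < \<infinity>"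
      using t0 by (simp_all add: nn_integral_powr_atLeast)
    ultimately show ?thesis
      by (simp add: ennreal_mult_less_top)
  qed
  finally show ?thesis .
qed

text \<open>Adding \<open>(\<sigma> k)\<^sup>2 / l\<^sup>2 / t\<close> makes every term nonnegative:
  for \<open>H k\<close> below 1/2 the power is at most 1/t, otherwise the coefficient is already
  nonnegative. The total then dominates the single term i.\<close>

lemma leading_sum_lower_bound:
  assumes t: "1 \<le> t"
  shows "leading_coeff i * t powr (2 * H i - 2) - (\<Sum>k. (\<sigma> k)\<^sup>2) / l\<^sup>2 / t
           \<le> (\<Sum>k. leading_coeff k * t powr (2 * H k - 2))"
proof -
  have t0: "0 < t" using t by simp
  let ?b = "\<lambda>k. leading_coeff k * t powr (2 * H k - 2) + (\<sigma> k)\<^sup>2 / l\<^sup>2 / t"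
  have s1: "summable (\<lambda>k. leading_coeff k * t powr (2 * H k - 2))"
    by (rule summable_norm_cancel) (use summable_leading[OF t0] in \<open>simp add: abs_mult\<close>)
  have s2: "summable (\<lambda>k. (\<sigma> k)\<^sup>2 / l\<^sup>2 / t)"
    by (intro summable_divide summable_\<sigma>)
  have nonneg: "0 \<le> ?b k" for k
  proof (cases "H k \<ge> 1/2")
    case True
    then have "0 \<le> leading_coeff k"
      using Hurst[of k] by (simp add: leading_coeff_def)
    then show ?thesis
      using t by simp
  next
    case False
    have "\<bar>leading_coeff k\<bar> * t powr (2 * H k - 2) \<le> (\<sigma> k)\<^sup>2 / l\<^sup>2 * t powr (- 1)"
      using False t by (intro mult_mono abs_leading_coeff_le powr_mono) auto
    also have "\<dots> = (\<sigma> k)\<^sup>2 / l\<^sup>2 / t"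
      using t by (simp add: powr_minus_divide)
    finally have "\<bar>leading_coeff k * t powr (2 * H k - 2)\<bar> \<le> (\<sigma> k)\<^sup>2 / l\<^sup>2 / t"
      by (simp add: abs_mult)
    then show ?thesis by linarith
  qed
  have "leading_coeff i * t powr (2 * H i - 2) \<le> ?b i"
    using t by simp
  also have "\<dots> = sum ?b {i}" by simp
  also have "\<dots> \<le> suminf ?b"
    by (rule sum_le_suminf[OF summable_add[OF s1 s2]]) (use nonneg in auto)
  also have "\<dots> = (\<Sum>k. leading_coeff k * t powr (2 * H k - 2)) + (\<Sum>k. (\<sigma> k)\<^sup>2 / l\<^sup>2 / t)"
    by (rule suminf_add[symmetric, OF s1 s2])
  also have "(\<Sum>k. (\<sigma> k)\<^sup>2 / l\<^sup>2 / t) = (\<Sum>k. (\<sigma> k)\<^sup>2) / l\<^sup>2 / t"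
    by (simp add: suminf_divide summable_divide summable_\<sigma>)
  finally show ?thesis by simp
qed

lemma autocovariance_ge_inverse:
  assumes i: "1/2 < H i" "\<sigma> i \<noteq> 0"
  shows "\<forall>\<^sub>F t in at_top. 1 / t \<le> \<bar>autocovariance P U t\<bar>"
proof -
  obtain K where K: "0 \<le> K"
    "\<And>t. 0 < t \<Longrightarrow> \<bar>autocovariance P U t - (\<Sum>k. leading_coeff k * t powr (2 * H k - 2))\<bar>
       \<le> K * (t powr (- 4) + t powr (- 2))"
    by (rule autocovariance_leading_term) blast
  \<comment> \<open>\<open>?C / t\<close> covers both losses: the negative components, and the
    error, whose two powers are each at most 1/t. Exceeding it by one more 1/t gives the
    claim.\<close>
  let ?C = "(\<Sum>k. (\<sigma> k)\<^sup>2) / l\<^sup>2 + 2 * K"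
  have a: "0 < leading_coeff i"
    using i l_pos by (simp add: leading_coeff_def)
  have "filterlim (\<lambda>t. leading_coeff i * t powr (2 * H i - 1)) at_top at_top"
    using i by (intro filterlim_tendsto_pos_mult_at_top[OF tendsto_const a] real_powr_at_top) simp
  then have "\<forall>\<^sub>F t in at_top. ?C + 1 \<le> leading_coeff i * t powr (2 * H i - 1)"
    by (simp add: filterlim_at_top)
  then show ?thesis
    using eventually_ge_at_top[of 1]
  proof eventually_elim
    case (elim t)
    then have t: "0 < t" by simp
    have "t powr (- 4) \<le> t powr (- 1)" "t powr (- 2) \<le> t powr (- 1)"
      using elim by (intro powr_mono; simp)+
    then have "K * (t powr (- 4) + t powr (- 2)) \<le> K * (2 * t powr (- 1))"
      using K(1) by (intro mult_left_mono) auto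
    also have "\<dots> = 2 * K / t"
      using t by (simp add: powr_minus_divide)
    finally have err: "K * (t powr (- 4) + t powr (- 2)) \<le> 2 * K / t" .
    have "leading_coeff i * t powr (2 * H i - 1) / t = leading_coeff i * t powr (2 * H i - 2)"
      using t by (simp add: powr_diff powr_numeral power2_eq_square)
    moreover have "(?C + 1) / t \<le> leading_coeff i * t powr (2 * H i - 1) / t"
      using elim t by (intro divide_right_mono) auto
    ultimately have "(\<Sum>k. (\<sigma> k)\<^sup>2) / l\<^sup>2 / t + 2 * K / t + 1 / t \<le> leading_coeff i * t powr (2 * H i - 2)"
      by (simp add: add_divide_distrib)
    then show "1 / t \<le> \<bar>autocovariance P U t\<bar>"
      using leading_sum_lower_bound[OF elim(2), of i] K(2)[OF t] err by linarith
  qed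
qed

lemma long_range_dependent_U_iff:
  assumes "\<And>k. \<sigma> k \<noteq> 0"
  shows "long_range_dependent P U \<longleftrightarrow> (\<exists>k. H k > 1/2)"
proof
  assume "long_range_dependent P U"
  then obtain t0 where "0 < t0" "(\<integral>\<^sup>+t\<in>{t0..}. ennreal \<bar>autocovariance P U t\<bar> \<partial>lborel) = \<infinity>"
    by (auto simp: long_range_dependent_def)
  then show "\<exists>k. H k > 1/2"
    using short_range_if_all_le_half[of t0] by (auto simp: not_less[symmetric])
next
  assume "\<exists>k. H k > 1/2"
  then obtain i where "1/2 < H i" by blast
  \<comment> \<open>The condition that t is at least 1 is added so that the threshold T is
    positive.\<close>
  from eventually_conj[OF autocovariance_ge_inverse[OF this assms] eventually_ge_at_top[of 1]]
  obtain T where T: "\<And>t. T \<le> t \<Longrightarrow> 1 / t \<le> \<bar>autocovariance P U t\<bar> \<and> 1 \<le> t"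
    by (auto simp: eventually_at_top_linorder)
  then have "0 < T" by force
  have "\<infinity> = (\<integral>\<^sup>+t\<in>{T..}. ennreal (1 / t) \<partial>lborel)"
    by (simp add: nn_integral_inverse_atLeast[OF \<open>0 < T\<close>])
  also have "\<dots> \<le> (\<integral>\<^sup>+t\<in>{T..}. ennreal \<bar>autocovariance P U t\<bar> \<partial>lborel)"
    using T by (intro nn_integral_mono) (auto split: split_indicator intro!: ennreal_leI)
  finally show "long_range_dependent P U"
    unfolding long_range_dependent_def
    using covariance_stationary_U \<open>0 < T\<close> by (auto simp: top_unique)
qed

end

theorem theorem3p2:
  fixes P :: "'a measure" and \<sigma> H :: "nat \<Rightarrow> real" and l :: real
    and M U :: "real \<Rightarrow> 'a \<Rightarrow> real" and \<rho> :: "real \<Rightarrow> real"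
  assumes "prob_space P"
    and "l > 0"
    and "\<And>k. \<sigma> k > 0"
    and "summable (\<lambda>k. (\<sigma> k)\<^sup>2)"
    and "\<And>k. 0 < H k \<and> H k < 1"
    and "inj H"
    and "(INF k. H k) > 0"
    and "(SUP k. H k) < 1"
    and "multi_mixed_fbm P \<sigma> H M"
    and "U = ornstein_uhlenbeck l M"
    and "\<rho> = autocovariance P U"
  shows "covariance_stationary P U \<and>
    (\<forall>s t. \<rho> t = (LINT \<omega>|P. U s \<omega> * U (s + t) \<omega>)) \<and>
    (\<forall>N::nat\<ge>1.
      (\<lambda>t. \<rho> t - 1/2 * (\<Sum>k. \<Sum>n=1..N. (\<sigma> k)\<^sup>2 * l powr (- 2 * real n) *
              (\<Prod>j=0..2*n-1. 2 * H k - real j) * t powr (2 * H k - 2 * real n)))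
      \<in> O[at_top](\<lambda>t. t powr (2 * (SUP k. H k) - 2 * real N - 2))) \<and>
    (long_range_dependent P U \<longleftrightarrow> (\<exists>k. H k > 1/2))"
proof -
  interpret prob_space P by fact
  interpret X: mixed_fou P \<sigma> H M l
    by unfold_locales (use assms in auto)
  have "\<sigma> k \<noteq> 0" for k
    using assms(3)[of k] by simp
  \<comment> \<open>For the second conjunct, the autocovariance and the covariance at (s, s + t)
    reduce to the same second difference of the variogram at t.\<close>
  then show ?thesis
    unfolding assms(10,11)
    using X.covariance_stationary_U X.autocovariance_bigo[unfolded X.autocovariance_expansion_def]
      X.long_range_dependent_U_iff
    by (simp add: X.autocovariance_U X.covariance_U)
qed

end
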